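(* Let $\phi(x)$ be a real polynomial of degree $2q+1$ with odd powers only, such that $\phi(\Sigma_k)$ is nonsingular and $\phi(\sigma_i)\ge\sigma_i$ for $1\le i\le k$. Set $$\Delta=\|\phi(\Sigma_{k,\perp})\|_2\,\|V_{k,\perp}^TX(V_k^TX)^{\dagger}\|_F.$$ If $\operatorname{rank}(V_k^TX)=k$, then for $1\le i\le k$, $$\|A-\hat U_i\hat U_i^TA\|_F\le\|A-A_i\|_F+\Delta,$$ $$\|A-\hat U_i\hat U_i^TA\|_2\le\|A-A_i\|_2+\Delta,$$ $$\sigma_i-\Delta\le\|\hat u_i^TA\|_2\le\sigma_i.$$ If, in addition, $X$ has orthonormal columns, then $$\Delta=\|\phi(\Sigma_{k,\perp})\|_2\,\|\tan\Theta(X,V_k)\|_F.$$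
   Context: Setting. $A\in\mathbb{R}^{m\times n}$, $X\in\mathbb{R}^{n\times s}$, and $A=U\Sigma V^T$ is a full SVD, with $U\in\mathbb{R}^{m\times m}$, $V\in\mathbb{R}^{n\times n}$ orthogonal and $\Sigma\in\mathbb{R}^{m\times n}$ diagonal with singular values $\sigma_1\ge\sigma_2\ge\cdots\ge 0$. Let $1\le k<\operatorname{rank}(A)$ and partition $\Sigma=\begin{pmatrix}\Sigma_k&\\&\Sigma_{k,\perp}\end{pmatrix}$, $U=\begin{pmatrix}U_k&U_{k,\perp}\end{pmatrix}$, $V=\begin{pmatrix}V_k&V_{k,\perp}\end{pmatrix}$, where $\Sigma_k=\operatorname{diag}(\sigma_1,\dots,\sigma_k)$ and $U_k,V_k$ have $k$ columns. It is assumed that $\sigma_k>\sigma_{k+1}>0$. For $1\le i\le k$, $A_i=U_i\Sigma_iV_i^T$, where $U_i,V_i$ are the first $i$ columns of $U,V$ and $\Sigma_i=\operatorname{diag}(\sigma_1,\dots,\sigma_i)$ (the best rank-$i$ approximation of $A$). Algorithm. Let $q\ge1$ be an integer with $k\le(q+1)s\le m$. Let $K_q=\begin{pmatrix}AX&(AA^T)AX&\cdots&(AA^T)^qAX\end{pmatrix}\in\mathbb{R}^{m\times(q+1)s}$, and assume $\operatorname{rank}(K_q)=(q+1)s$. Let $U_K\in\mathbb{R}^{m\times(q+1)s}$ have orthonormal columns spanning $\operatorname{range}(K_q)$. Set $W=U_K^TA$ and assume $\operatorname{rank}(W)\ge k$. Let $U_{W,k}\in\mathbb{R}^{(q+1)s\times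 k}$ be the matrix whose columns are (orthonormal) left singular vectors of $W$ associated with its $k$ largest singular values, in non-increasing order of the singular values. The output is $\hat U_k=U_KU_{W,k}=\begin{pmatrix}\hat u_1&\cdots&\hat u_k\end{pmatrix}\in\mathbb{R}^{m\times k}$, and $\hat U_i=\begin{pmatrix}\hat u_1&\cdots&\hat u_i\end{pmatrix}$ for $1\le i\le k$. Notation. For a rectangular diagonal matrix $D$, $\phi(D)$ is the diagonal matrix of the same dimensions obtained by applying $\phi$ to the diagonal entries only. $\|\cdot\|_2$ is the spectral norm (Euclidean norm for vectors), $\|\cdot\|_F$ the Frobenius norm, and $\dagger$ the Moore-Penrose inverse. Principal angles. For $X\in\mathbb{R}^{n\times s}$ with orthonormal columns and $k\le s$, the principal angles $0\le\theta_1\le\cdots\le\theta_k\le\pi/2$ between $\operatorname{range}(X)$ and $\operatorname{range}(V_k)$ are given by $\cos\theta_j=\sigma_j(V_k^TX)$; $\Theta(X,V_k)=\operatorname{diag}(\theta_1,\dots,\theta_k)$ and $\tan\Theta$ applies $\tan$ to each diagonal angle (used only when $\theta_k<\pi/2$). *)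

theory Defs
  imports
    "HOL-Analysis.Analysis"
    "Jordan_Normal_Form.Matrix"
    "Jordan_Normal_Form.DL_Rank"
begin

abbreviation mat_rank :: "real mat \<Rightarrow> nat" where
  "mat_rank M \<equiv> vec_space.rank (dim_row M) M"

abbreviation mat_range :: "real mat \<Rightarrow> real vec set" where
  "mat_range M \<equiv> vec_space.col_space (dim_row M) M"

definition orthonormal_cols :: "real mat \<Rightarrow> bool" where
  "orthonormal_cols M \<longleftrightarrow> transpose_mat M * M = 1\<^sub>m (dim_col M)"

definition vec_norm2 :: "real vec \<Rightarrow> real" where
  "vec_norm2 v = sqrt (v \<bullet> v)"

definition frob_norm :: "real mat \<Rightarrow> real" where
  "frob_norm M = sqrt (\<Sum>i<dim_row M. \<Sum>j<dim_col M. (M $$ (i,j))\<^sup>2)"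

definition spectral_norm :: "real mat \<Rightarrow> real" where
  "spectral_norm M = (SUP x\<in>{x \<in> carrier_vec (dim_col M). vec_norm2 x \<le> 1}. vec_norm2 (M *\<^sub>v x))"

definition pinv :: "real mat \<Rightarrow> real mat" where
  "pinv M = (THE Y. Y \<in> carrier_mat (dim_col M) (dim_row M) \<and>
     M * Y * M = M \<and> Y * M * Y = Y \<and>
     transpose_mat (M * Y) = M * Y \<and> transpose_mat (Y * M) = Y * M)"

definition leading_cols :: "nat \<Rightarrow> real mat \<Rightarrow> real mat" where
  "leading_cols k M = mat (dim_row M) k (\<lambda>(i,j). M $$ (i,j))"

definition trailing_cols :: "nat \<Rightarrow> real mat \<Rightarrow> real mat" where
  "trailing_cols k M = mat (dim_row M) (dim_col M - k) (\<lambda>(i,j). M $$ (i, j + k))"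

definition leading_block :: "nat \<Rightarrow> real mat \<Rightarrow> real mat" where
  "leading_block k M = mat k k (\<lambda>(i,j). M $$ (i,j))"

definition trailing_block :: "nat \<Rightarrow> real mat \<Rightarrow> real mat" where
  "trailing_block k M = mat (dim_row M - k) (dim_col M - k) (\<lambda>(i,j). M $$ (i + k, j + k))"

text \<open>Off-diagonal entries stay zero even if \<open>f 0 \<noteq> 0\<close>; \<open>D\<close> may be rectangular.\<close>

definition diag_apply :: "(real \<Rightarrow> real) \<Rightarrow> real mat \<Rightarrow> real mat" where
  "diag_apply f D = mat (dim_row D) (dim_col D) (\<lambda>(i,j). if i = j then f (D $$ (i,i)) else 0)"

text \<open>Full SVD \<open>A = U S V\<^sup>T\<close> with non-increasing, nonnegative diagonal of \<open>S\<close>.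
  Matrix indices start at 0, so the singular value \<open>\<sigma>\<^sub>i\<close> of the
  usual numbering is \<open>S $$ (i - 1, i - 1)\<close>.\<close>

definition full_svd :: "real mat \<Rightarrow> real mat \<Rightarrow> real mat \<Rightarrow> real mat \<Rightarrow> bool" where
  "full_svd A U S V \<longleftrightarrow>
     U \<in> carrier_mat (dim_row A) (dim_row A) \<and> orthonormal_cols U \<and>
     V \<in> carrier_mat (dim_col A) (dim_col A) \<and> orthonormal_cols V \<and>
     S \<in> carrier_mat (dim_row A) (dim_col A) \<and> diagonal_mat S \<and>
     (\<forall>i < min (dim_row A) (dim_col A). 0 \<le> S $$ (i,i)) \<and>
     (\<forall>i j. i \<le> j \<and> j < min (dim_row A) (dim_col A) \<longrightarrow> S $$ (j,j) \<le> S $$ (i,i)) \<and>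
     A = U * S * transpose_mat V"

text \<open>\<open>sing_val M i\<close> is the \<open>i\<close>-th largest singular value (numbered from 1),
  meaningful for \<open>1 \<le> i \<le> min (dim_row M) (dim_col M)\<close>.\<close>

definition sing_val :: "real mat \<Rightarrow> nat \<Rightarrow> real" where
  "sing_val M i = (THE x. \<exists>U S V. full_svd M U S V \<and> x = S $$ (i - 1, i - 1))"

text \<open>An orthonormal system of left singular vectors for the \<open>k\<close> largest singular values,
  in non-increasing order of these, is exactly what some full SVD has as the first \<open>k\<close>
  columns of its left factor.\<close>

definition top_left_singular_vectors :: "real mat \<Rightarrow> nat \<Rightarrow> real mat \<Rightarrow> bool" where
  "top_left_singular_vectors W k P \<longleftrightarrow>
     k \<le> dim_row W \<and> (\<exists>U S V. full_svd W U S V \<and> P = leading_cols k U)"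

definition truncated_svd :: "nat \<Rightarrow> real mat \<Rightarrow> real mat \<Rightarrow> real mat \<Rightarrow> real mat" where
  "truncated_svd i U S V =
     leading_cols i U * leading_block i S * transpose_mat (leading_cols i V)"

text \<open>Block Krylov matrix with the blocks \<open>(A A\<^sup>T)\<^sup>j A X\<close>, \<open>j = 0, \<dots>, q\<close>, side by side.\<close>

definition krylov_mat :: "real mat \<Rightarrow> real mat \<Rightarrow> nat \<Rightarrow> real mat" where
  "krylov_mat A X q = mat_of_cols (dim_row A)
     (concat (map (\<lambda>j. cols (((A * transpose_mat A) ^\<^sub>m j) * A * X)) [0..<q + 1]))"

text \<open>\<open>cos \<theta>\<^sub>j = \<sigma>\<^sub>j(Y\<^sup>T X)\<close> with \<open>0 \<le> \<theta>\<^sub>j \<le> \<pi>/2\<close>,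
  for \<open>X\<close> and \<open>Y\<close> with orthonormal columns, \<open>j = 1, \<dots>, dim_col Y\<close>; since \<open>mat_diag\<close>
  counts from 0, entry \<open>j\<close> holds \<open>\<theta>\<close> with index \<open>j + 1\<close>.\<close>

definition principal_angle :: "real mat \<Rightarrow> real mat \<Rightarrow> nat \<Rightarrow> real" where
  "principal_angle X Y j = arccos (sing_val (transpose_mat Y * X) j)"

definition principal_angles_mat :: "real mat \<Rightarrow> real mat \<Rightarrow> real mat" where
  "principal_angles_mat X Y = mat_diag (dim_col Y) (\<lambda>j. principal_angle X Y (j + 1))"

end

theory Submission
  imports Defs
begin

text \<open>
  Write \<open>\<sigma>\<^sub>j, u\<^sub>j, v\<^sub>j\<close> for the singular triplets of \<open>A\<close>, and call
  \<open>\<Sum>\<^sub>j\<^sub>\<le>\<^sub>i \<parallel>A\<^sup>T y\<^sub>j\<parallel>\<^sup>2\<close> the energy captured by an orthonormal system \<open>y\<^sub>1, \<dots>, y\<^sub>i\<close>. By Ky Fan's maximum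
  principle no system captures more than \<open>\<sigma>\<^sub>1\<^sup>2 + \<dots> + \<sigma>\<^sub>i\<^sup>2\<close>. Every bound of the theorem except
  \<open>\<parallel>A\<^sup>T u\<parallel> \<le> \<sigma>\<^sub>i\<close> for the \<open>i\<close>-th computed vector \<open>u\<close> follows once the first \<open>i\<close> computed vectors
  are known to miss this maximum by at most \<open>\<Delta>\<^sup>2\<close>.

  For the Frobenius norm, the squared residual of a projection is \<open>\<parallel>A\<parallel>\<^sub>F\<^sup>2\<close> minus the captured energy,
  and \<open>A - A\<^sub>i\<close> is the residual of the projection that captures the maximum; so the two squared residuals
  differ by at most \<open>\<Delta>\<^sup>2\<close>. For the spectral norm, adjoin one more unit vector \<open>y\<close>, orthogonal to the
  computed ones: by Ky Fan for \<open>i + 1\<close> vectors, \<open>\<parallel>A\<^sup>T y\<parallel>\<^sup>2 \<le> \<sigma>\<^sub>i\<^sub>+\<^sub>1\<^sup>2 + \<Delta>\<^sup>2\<close>, which bounds the residual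
  in every direction. For the lower bound on the \<open>i\<close>-th computed value, apply Ky Fan to the first
  \<open>i - 1\<close> computed vectors. In each case \<open>sqrt (a\<^sup>2 + \<Delta>\<^sup>2) \<le> a + \<Delta>\<close> finishes the argument.

  It remains to bound the missed energy. The computed vectors come from the leading left singular vectors
  of \<open>W = Q\<^sup>T A\<close>, where \<open>Q\<close> is the orthonormal basis of the Krylov space. Hence their energy is the sum of
  the \<open>i\<close> largest squared singular values of \<open>W\<close>, and Ky Fan, now for \<open>W\<close>, bounds it below by
  \<open>\<Sum>\<^sub>j\<^sub>\<le>\<^sub>i \<parallel>W v\<^sub>j\<parallel>\<^sup>2 = \<Sum>\<^sub>j\<^sub>\<le>\<^sub>i \<sigma>\<^sub>j\<^sup>2 \<parallel>Q\<^sup>T u\<^sub>j\<parallel>\<^sup>2\<close>. So \<open>\<sigma>\<^sub>j\<^sup>2 - \<parallel>W v\<^sub>j\<parallel>\<^sup>2\<close> is \<open>\<sigma>\<^sub>j\<^sup>2\<close> times the squared distance of \<open>u\<^sub>j\<close>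
  from the Krylov space. Let \<open>w\<close> be column \<open>j\<close> of the pseudoinverse of \<open>V\<^sub>k\<^sup>T X\<close>. As \<open>\<phi>\<close> is odd of degree
  \<open>2q + 1\<close>, the Krylov space contains \<open>\<phi>(A) X w\<close>, with \<open>\<phi>(A) = U \<phi>(\<Sigma>) V\<^sup>T\<close>. This vector is
  \<open>\<phi>(\<sigma>\<^sub>j) u\<^sub>j\<close> plus an error of norm \<open>\<parallel>\<phi>(\<Sigma>\<^sub>\<perp>) t\<^sub>j\<parallel>\<close>, where \<open>t\<^sub>j\<close> is column \<open>j\<close> of \<open>V\<^sub>\<perp>\<^sup>T X (V\<^sub>k\<^sup>T X)\<^sup>\<dagger>\<close>. Since
  \<open>\<sigma>\<^sub>j \<le> \<phi>(\<sigma>\<^sub>j)\<close>, the energy missed at \<open>j\<close> is at most \<open>\<parallel>\<phi>(\<Sigma>\<^sub>\<perp>) t\<^sub>j\<parallel>\<^sup>2\<close>, and these terms sum to at most \<open>\<Delta>\<^sup>2\<close>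
  (lemma \<open>krylov_energy\<close>).

  The upper bound \<open>\<parallel>A\<^sup>T u\<parallel> \<le> \<sigma>\<^sub>i\<close> says that compressing \<open>A\<close> to a subspace does not increase singular
  values, a min-max argument. The formula with principal angles comes from evaluating
  \<open>\<parallel>V\<^sub>\<perp>\<^sup>T X (V\<^sub>k\<^sup>T X)\<^sup>\<dagger>\<parallel>\<^sub>F\<close> in the basis of left singular vectors of \<open>V\<^sub>k\<^sup>T X\<close>: the \<open>j\<close>-th one contributes
  \<open>1 / cos\<^sup>2 \<theta>\<^sub>j - 1 = tan\<^sup>2 \<theta>\<^sub>j\<close>. It needs a singular value decomposition of \<open>V\<^sub>k\<^sup>T X\<close>, whose existence is
  proved by a compactness argument, and the uniqueness of singular values.

  This overview counts singular values and vectors from 1; the lemmas below count them from 0, as matrix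
  indices do.
\<close>

text \<open>From here on the bullet and the dollar sign mean scalar product and entry of the vectors of
  arbitrary length on which the statement is based, and never the operations on Euclidean spaces.\<close>

unbundle no inner_syntax and no vec_syntax

section \<open>Orthonormal columns\<close>

lemma scalar_prod_self_sum:
  fixes v :: "real vec"
  shows "v \<bullet> v = (\<Sum>i<dim_vec v. (v $ i)\<^sup>2)"
  by (simp add: scalar_prod_def power2_eq_square atLeast0LessThan)

lemma scalar_prod_self_nonneg [simp]:
  fixes v :: "real vec"
  shows "0 \<le> v \<bullet> v"
  by (simp add: scalar_prod_self_sum sum_nonneg)

lemma scalar_prod_self_eq_0:
  fixes v :: "real vec"
  assumes "v \<bullet> v = 0" "v \<in> carrier_vec n"
  shows "v = 0\<^sub>v n"
  using assms by (auto simp: scalar_prod_self_sum sum_nonneg_eq_0_iff intro!: eq_vecI)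

lemma scalar_prod_comm_dim:
  fixes v w :: "real vec"
  assumes "dim_vec v = dim_vec w"
  shows "v \<bullet> w = w \<bullet> v"
  using comm_scalar_prod[of v "dim_vec v" w] assms by (metis carrier_vec_dim_vec)

lemma scalar_prod_smult_self:
  fixes v :: "real vec"
  shows "(c \<cdot>\<^sub>v v) \<bullet> (c \<cdot>\<^sub>v v) = c\<^sup>2 * (v \<bullet> v)"
  by (simp add: power2_eq_square)

lemma scalar_prod_diff_self:
  fixes v w :: "real vec"
  assumes "v \<in> carrier_vec n" "w \<in> carrier_vec n"
  shows "(v - w) \<bullet> (v - w) = v \<bullet> v - 2 * (v \<bullet> w) + w \<bullet> w"
  using assms comm_scalar_prod[of v n w]
  by (simp add: minus_scalar_prod_distrib scalar_prod_minus_distrib)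

lemma vec_norm2_nonneg [simp]: "0 \<le> vec_norm2 v"
  by (simp add: vec_norm2_def)

lemma vec_norm2_square [simp]: "(vec_norm2 v)\<^sup>2 = v \<bullet> v"
  by (simp add: vec_norm2_def)

lemma vec_Cauchy_Schwarz:
  fixes v w :: "real vec"
  assumes "v \<in> carrier_vec n" "w \<in> carrier_vec n"
  shows "(v \<bullet> w)\<^sup>2 \<le> (v \<bullet> v) * (w \<bullet> w)"
  using assms Cauchy_Schwarz_ineq_sum[of "\<lambda>i. v $ i" "\<lambda>i. w $ i" "{..<n}"]
  by (simp add: scalar_prod_self_sum)
     (simp add: scalar_prod_def atLeast0LessThan)

lemma transpose_mult_vec_index:
  fixes Q :: "real mat"
  assumes "i < dim_col Q"
  shows "(transpose_mat Q *\<^sub>v x) $ i = col Q i \<bullet> x"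
  using assms by simp

lemma transpose_mult_vec_self:
  fixes Q :: "real mat"
  shows "(transpose_mat Q *\<^sub>v x) \<bullet> (transpose_mat Q *\<^sub>v x) = (\<Sum>j<dim_col Q. (col Q j \<bullet> x)\<^sup>2)"
  by (simp add: scalar_prod_self_sum)

lemma orthonormal_cols_iff:
  "orthonormal_cols Q \<longleftrightarrow>
     (\<forall>i<dim_col Q. \<forall>j<dim_col Q. col Q i \<bullet> col Q j = (if i = j then 1 else 0))"
  by (auto simp: orthonormal_cols_def mat_eq_iff)

lemma orthonormal_cols_mult:
  assumes Q: "orthonormal_cols Q" "Q \<in> carrier_mat n r" and R: "orthonormal_cols R" "R \<in> carrier_mat r p"
  shows "orthonormal_cols (Q * R)"
proof -
  have QR: "Q * R \<in> carrier_mat n p" using Q R by simp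
  have "transpose_mat (Q * R) * (Q * R) = transpose_mat R * (transpose_mat Q * (Q * R))"
    using Q(2) R(2) QR by (simp add: transpose_mult[OF Q(2) R(2)]
      assoc_mult_mat[of "transpose_mat R" p r "transpose_mat Q" n "Q * R" p])
  also have "transpose_mat Q * (Q * R) = transpose_mat Q * Q * R"
    using Q(2) R(2) by (intro assoc_mult_mat[symmetric]) auto
  finally have "transpose_mat (Q * R) * (Q * R) = transpose_mat R * (transpose_mat Q * Q * R)" .
  then show ?thesis using Q R by (simp add: orthonormal_cols_def del: assoc_mult_mat)
qed

lemma orthonormal_cols_transpose:
  assumes "orthonormal_cols Q" "Q \<in> carrier_mat n n"
  shows "orthonormal_cols (transpose_mat Q)"
  using assms mat_mult_left_right_inverse[of "transpose_mat Q" n Q]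
  by (simp add: orthonormal_cols_def)

lemma orthonormal_cols_leading_cols:
  assumes "orthonormal_cols Q" "i \<le> dim_col Q"
  shows "orthonormal_cols (leading_cols i Q)"
proof -
  have *: "col (leading_cols i Q) j = col Q j" if "j < i" for j
    using that assms(2) by (intro eq_vecI) (auto simp: leading_cols_def)
  have "dim_col (leading_cols i Q) = i" by (simp add: leading_cols_def)
  then show ?thesis using assms * by (simp add: orthonormal_cols_iff)
qed

lemma mult_vec_scalar_prod:
  fixes Q :: "real mat"
  assumes "Q \<in> carrier_mat n r" "a \<in> carrier_vec r" "x \<in> carrier_vec n"
  shows "(Q *\<^sub>v a) \<bullet> x = a \<bullet> (transpose_mat Q *\<^sub>v x)"
  using transpose_vec_mult_scalar[OF assms(1,2,3)] assms
  by (metis comm_scalar_prod mult_mat_vec_carrier transpose_carrier_mat)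

lemma orthonormal_cols_left_inverse:
  assumes Q: "orthonormal_cols Q" "Q \<in> carrier_mat n r" and a: "a \<in> carrier_vec r"
  shows "transpose_mat Q *\<^sub>v (Q *\<^sub>v a) = a"
  using Q a assoc_mult_mat_vec[of "transpose_mat Q" r n Q r a]
  by (simp add: orthonormal_cols_def)

lemma orthonormal_cols_isometry:
  assumes Q: "orthonormal_cols Q" "Q \<in> carrier_mat n r" and a: "a \<in> carrier_vec r"
  shows "(Q *\<^sub>v a) \<bullet> (Q *\<^sub>v a) = a \<bullet> a"
  using mult_vec_scalar_prod[OF Q(2) a, of "Q *\<^sub>v a"] orthonormal_cols_left_inverse[OF assms] Q a
  by simp

lemma parseval:
  assumes Q: "orthonormal_cols Q" "Q \<in> carrier_mat n n" and x: "x \<in> carrier_vec n"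
  shows "(\<Sum>j<n. (col Q j \<bullet> x)\<^sup>2) = x \<bullet> x"
  using orthonormal_cols_isometry[OF orthonormal_cols_transpose[OF Q], of n n x]
    transpose_mult_vec_self[of Q x] Q x by simp

text \<open>Pythagoras for the orthogonal projection onto the range of \<open>Q\<close>.\<close>

lemma orthonormal_residual:
  assumes Q: "orthonormal_cols Q" "Q \<in> carrier_mat n r" and x: "x \<in> carrier_vec n"
  shows "(x - Q *\<^sub>v (transpose_mat Q *\<^sub>v x)) \<bullet> (x - Q *\<^sub>v (transpose_mat Q *\<^sub>v x))
    = x \<bullet> x - (transpose_mat Q *\<^sub>v x) \<bullet> (transpose_mat Q *\<^sub>v x)"
proof -
  have c: "transpose_mat Q *\<^sub>v x \<in> carrier_vec r" using Q x by simp
  have "x \<bullet> (Q *\<^sub>v (transpose_mat Q *\<^sub>v x)) = (transpose_mat Q *\<^sub>v x) \<bullet> (transpose_mat Q *\<^sub>v x)"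
    using transpose_vec_mult_scalar[OF Q(2) c x] by simp
  then show ?thesis
    using scalar_prod_diff_self[of x n "Q *\<^sub>v (transpose_mat Q *\<^sub>v x)"]
      orthonormal_cols_isometry[OF Q c] Q x by simp
qed

lemma bessel:
  assumes Q: "orthonormal_cols Q" "Q \<in> carrier_mat n r" and x: "x \<in> carrier_vec n"
  shows "(\<Sum>j<r. (col Q j \<bullet> x)\<^sup>2) \<le> x \<bullet> x"
proof -
  have "0 \<le> x \<bullet> x - (transpose_mat Q *\<^sub>v x) \<bullet> (transpose_mat Q *\<^sub>v x)"
    unfolding orthonormal_residual[OF assms, symmetric] by simp
  then show ?thesis using transpose_mult_vec_self[of Q x] Q by simp
qed

section \<open>Frobenius and spectral norm\<close>

lemma frob_norm_nonneg [simp]: "0 \<le> frob_norm M"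
  by (simp add: frob_norm_def sum_nonneg)

lemma frob_norm_square_cols:
  "(frob_norm M)\<^sup>2 = (\<Sum>j<dim_col M. col M j \<bullet> col M j)"
proof -
  have "(frob_norm M)\<^sup>2 = (\<Sum>i<dim_row M. \<Sum>j<dim_col M. (M $$ (i,j))\<^sup>2)"
    by (simp add: frob_norm_def sum_nonneg)
  also have "\<dots> = (\<Sum>j<dim_col M. col M j \<bullet> col M j)"
    by (subst sum.swap) (simp add: scalar_prod_self_sum)
  finally show ?thesis .
qed

lemma frob_norm_square_rows:
  "(frob_norm M)\<^sup>2 = (\<Sum>i<dim_row M. row M i \<bullet> row M i)"
  by (simp add: frob_norm_def sum_nonneg scalar_prod_self_sum)

text \<open>The Frobenius norm may be evaluated in any orthonormal basis of the domain; a basis of singular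
  vectors makes \<open>frob_norm_tan_principal_angles\<close> a computation with numbers.\<close>

lemma frob_norm_square_basis:
  assumes Q: "orthonormal_cols Q" "Q \<in> carrier_mat n n" and M: "M \<in> carrier_mat r n"
  shows "(frob_norm M)\<^sup>2 = (\<Sum>j<n. (M *\<^sub>v col Q j) \<bullet> (M *\<^sub>v col Q j))"
proof -
  have "(frob_norm M)\<^sup>2 = (\<Sum>i<r. \<Sum>j<n. (col Q j \<bullet> row M i)\<^sup>2)"
    using M by (simp add: frob_norm_square_rows parseval[OF Q])
  also have "\<dots> = (\<Sum>j<n. \<Sum>i<r. (row M i \<bullet> col Q j)\<^sup>2)"
    using Q M by (subst sum.swap) (intro sum.cong refl, simp add: comm_scalar_prod[of _ n])
  also have "\<dots> = (\<Sum>j<n. (M *\<^sub>v col Q j) \<bullet> (M *\<^sub>v col Q j))"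
    using M by (simp add: scalar_prod_self_sum)
  finally show ?thesis .
qed

text \<open>Pythagoras in every column: what a projection leaves of \<open>A\<close> is what it does not capture.
  This turns Frobenius errors into captured energy.\<close>

lemma frob_norm_square_residual:
  assumes Q: "orthonormal_cols Q" "Q \<in> carrier_mat m r" and A: "A \<in> carrier_mat m n"
  shows "(frob_norm (A - Q * transpose_mat Q * A))\<^sup>2
    = (frob_norm A)\<^sup>2 - (\<Sum>j<r. (transpose_mat A *\<^sub>v col Q j) \<bullet> (transpose_mat A *\<^sub>v col Q j))"
proof -
  have col: "col (A - Q * transpose_mat Q * A) c
    = col A c - Q *\<^sub>v (transpose_mat Q *\<^sub>v col A c)" if "c < n" for c
  proof -
    have "col (Q * transpose_mat Q * A) c = Q *\<^sub>v (transpose_mat Q *\<^sub>v col A c)"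
      using Q A that by (subst col_mult2[of _ m m _ n])
        (auto intro!: assoc_mult_mat_vec)
    moreover have "col (A - Q * transpose_mat Q * A) c = col A c - col (Q * transpose_mat Q * A) c"
      using Q A that by (intro eq_vecI) auto
    ultimately show ?thesis by simp
  qed
  have "(frob_norm (A - Q * transpose_mat Q * A))\<^sup>2
    = (\<Sum>c<n. (col A c \<bullet> col A c) - (transpose_mat Q *\<^sub>v col A c) \<bullet> (transpose_mat Q *\<^sub>v col A c))"
    using Q A by (simp add: frob_norm_square_cols col orthonormal_residual[OF Q] del: assoc_mult_mat)
  also have "\<dots> = (frob_norm A)\<^sup>2 - (\<Sum>c<n. \<Sum>j<r. (col Q j \<bullet> col A c)\<^sup>2)"
    using Q A by (simp add: frob_norm_square_cols sum_subtractf transpose_mult_vec_self)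
  also have "(\<Sum>c<n. \<Sum>j<r. (col Q j \<bullet> col A c)\<^sup>2) = (\<Sum>j<r. \<Sum>c<n. (col A c \<bullet> col Q j)\<^sup>2)"
    using Q A by (subst sum.swap) (intro sum.cong refl, simp add: comm_scalar_prod[of _ m])
  also have "\<dots> = (\<Sum>j<r. (transpose_mat A *\<^sub>v col Q j) \<bullet> (transpose_mat A *\<^sub>v col Q j))"
    using A by (simp add: transpose_mult_vec_self)
  finally show ?thesis .
qed

text \<open>Serves to see that the supremum that defines the spectral norm is taken over a bounded set.\<close>

lemma mult_vec_le_frob_norm:
  assumes x: "x \<in> carrier_vec (dim_col M)"
  shows "vec_norm2 (M *\<^sub>v x) \<le> frob_norm M * vec_norm2 x"
proof (rule power2_le_imp_le)
  have "(M *\<^sub>v x) \<bullet> (M *\<^sub>v x) = (\<Sum>i<dim_row M. (row M i \<bullet> x)\<^sup>2)"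
    by (simp add: scalar_prod_self_sum)
  also have "\<dots> \<le> (\<Sum>i<dim_row M. (row M i \<bullet> row M i) * (x \<bullet> x))"
    using x by (intro sum_mono vec_Cauchy_Schwarz[of _ "dim_col M"]) auto
  also have "\<dots> = (frob_norm M * vec_norm2 x)\<^sup>2"
    by (simp add: frob_norm_square_rows power_mult_distrib sum_distrib_right)
  finally show "(vec_norm2 (M *\<^sub>v x))\<^sup>2 \<le> (frob_norm M * vec_norm2 x)\<^sup>2" by simp
qed simp

lemma vec_norm2_smult: "vec_norm2 (c \<cdot>\<^sub>v v) = \<bar>c\<bar> * vec_norm2 v"
  by (simp add: vec_norm2_def real_sqrt_mult flip: mult.assoc)

lemma spectral_norm_bdd:
  "bdd_above ((\<lambda>x. vec_norm2 (M *\<^sub>v x)) ` {x \<in> carrier_vec (dim_col M). vec_norm2 x \<le> 1})"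
proof (rule bdd_aboveI2)
  fix x :: "real vec" assume x: "x \<in> {x \<in> carrier_vec (dim_col M). vec_norm2 x \<le> 1}"
  then have "vec_norm2 (M *\<^sub>v x) \<le> frob_norm M * vec_norm2 x" by (simp add: mult_vec_le_frob_norm)
  also have "\<dots> \<le> frob_norm M * 1" using x by (intro mult_left_mono) auto
  finally show "vec_norm2 (M *\<^sub>v x) \<le> frob_norm M" by simp
qed

lemma vec_norm2_zero [simp]: "vec_norm2 (0\<^sub>v n) = 0"
  by (simp add: vec_norm2_def)

lemma spectral_norm_bound:
  assumes x: "x \<in> carrier_vec (dim_col M)"
  shows "vec_norm2 (M *\<^sub>v x) \<le> spectral_norm M * vec_norm2 x"
proof (cases "vec_norm2 x = 0")
  case True
  then show ?thesis using mult_vec_le_frob_norm[OF x] by simp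
next
  case False
  define c where "c = vec_norm2 x"
  have c: "c > 0" using False by (simp add: c_def less_le)
  let ?y = "(1/c) \<cdot>\<^sub>v x"
  have "vec_norm2 (M *\<^sub>v ?y) \<le> spectral_norm M"
    unfolding spectral_norm_def using x c
    by (intro cSUP_upper spectral_norm_bdd) (auto simp: vec_norm2_smult c_def[symmetric])
  moreover have "M *\<^sub>v ?y = (1/c) \<cdot>\<^sub>v (M *\<^sub>v x)"
    using x by (intro mult_mat_vec[of M "dim_row M" "dim_col M"]) auto
  ultimately show ?thesis using c by (simp add: vec_norm2_smult c_def[symmetric] field_simps)
qed

lemma spectral_norm_nonneg: "0 \<le> spectral_norm M"
proof -
  have "vec_norm2 (M *\<^sub>v 0\<^sub>v (dim_col M)) \<le> spectral_norm M"
    unfolding spectral_norm_def by (intro cSUP_upper spectral_norm_bdd) auto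
  then show ?thesis using vec_norm2_nonneg order_trans by blast
qed

lemma spectral_norm_leI:
  assumes "\<And>x. x \<in> carrier_vec (dim_col M) \<Longrightarrow> vec_norm2 (M *\<^sub>v x) \<le> c * vec_norm2 x" "0 \<le> c"
  shows "spectral_norm M \<le> c"
  unfolding spectral_norm_def
proof (rule cSUP_least)
  show "{x \<in> carrier_vec (dim_col M). vec_norm2 x \<le> 1} \<noteq> {}"
    by (auto intro!: exI[of _ "0\<^sub>v (dim_col M)"])
  fix x :: "real vec" assume x: "x \<in> {x \<in> carrier_vec (dim_col M). vec_norm2 x \<le> 1}"
  then have "vec_norm2 (M *\<^sub>v x) \<le> c * vec_norm2 x" using assms(1) by simp
  also have "\<dots> \<le> c * 1" using x assms(2) by (intro mult_left_mono) auto
  finally show "vec_norm2 (M *\<^sub>v x) \<le> c" by simp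
qed

section \<open>Singular value decompositions\<close>

lemma full_svdD:
  assumes "full_svd A U S V" "A \<in> carrier_mat m n"
  shows "U \<in> carrier_mat m m" "orthonormal_cols U" "V \<in> carrier_mat n n" "orthonormal_cols V"
    "S \<in> carrier_mat m n" "diagonal_mat S"
    "A = U * S * transpose_mat V"
    "\<And>i. i < min m n \<Longrightarrow> 0 \<le> S $$ (i,i)"
    "\<And>i j. i \<le> j \<Longrightarrow> j < min m n \<Longrightarrow> S $$ (j,j) \<le> S $$ (i,i)"
  using assms by (auto simp: full_svd_def)

lemma full_svd_transpose:
  assumes "full_svd A U S V" "A \<in> carrier_mat m n"
  shows "full_svd (transpose_mat A) V (transpose_mat S) U"
proof -
  note D = full_svdD[OF assms]
  have "transpose_mat A = V * (transpose_mat S * transpose_mat U)"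
    using D(1,3,5) unfolding D(7)
    by (subst transpose_mult[of _ m n _ n], simp, simp, subst transpose_mult[of U m m S n], auto)
  also have "\<dots> = V * transpose_mat S * transpose_mat U"
    using D(1,3,5) by (intro assoc_mult_mat[symmetric]) auto
  finally have "transpose_mat A = V * transpose_mat S * transpose_mat U" .
  moreover have "diagonal_mat (transpose_mat S)"
    using D(5,6) by (auto simp: diagonal_mat_def)
  moreover have "transpose_mat S $$ (i,i) = S $$ (i,i)" if "i < min m n" for i
    using D(5) that by simp
  ultimately show ?thesis
    using D(1-6,8,9) assms(2) by (auto simp: full_svd_def)
qed

lemma diagonal_mult_vec_index:
  fixes S :: "real mat"
  assumes "S \<in> carrier_mat m n" "diagonal_mat S" "y \<in> carrier_vec n" "l < m"
  shows "(S *\<^sub>v y) $ l = (if l < n then S $$ (l,l) * y $ l else 0)"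
proof -
  have "(S *\<^sub>v y) $ l = (\<Sum>j<n. S $$ (l,j) * y $ j)"
    using assms by (simp add: scalar_prod_def atLeast0LessThan)
  also have "\<dots> = (\<Sum>j<n. if j = l then S $$ (l,l) * y $ l else 0)"
    using assms by (intro sum.cong refl) (auto simp: diagonal_mat_def)
  finally show ?thesis by (simp add: sum.delta)
qed

lemma full_svd_mult_vec:
  assumes "full_svd A U S V" "A \<in> carrier_mat m n" "x \<in> carrier_vec n"
  shows "A *\<^sub>v x = U *\<^sub>v (S *\<^sub>v (transpose_mat V *\<^sub>v x))"
proof -
  note D = full_svdD[OF assms(1,2)]
  have "A *\<^sub>v x = U * S *\<^sub>v (transpose_mat V *\<^sub>v x)"
    using D(1,3,5) assms(3) unfolding D(7) by (intro assoc_mult_mat_vec[of _ m n _ n]) auto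
  also have "\<dots> = U *\<^sub>v (S *\<^sub>v (transpose_mat V *\<^sub>v x))"
    using D(1,3,5) assms(3) by (intro assoc_mult_mat_vec[of _ m m _ n]) auto
  finally show ?thesis .
qed

text \<open>In the two singular bases \<open>A\<close> acts diagonally. All later computations with \<open>A\<close> rest on this
  and on Parseval's identity.\<close>

lemma full_svd_coord:
  assumes svd: "full_svd A U S V" "A \<in> carrier_mat m n" and x: "x \<in> carrier_vec n" and l: "l < m"
  shows "col U l \<bullet> (A *\<^sub>v x) = (if l < n then S $$ (l,l) * (col V l \<bullet> x) else 0)"
proof -
  note D = full_svdD[OF svd]
  have y: "S *\<^sub>v (transpose_mat V *\<^sub>v x) \<in> carrier_vec m" using D x by simp
  have "transpose_mat U *\<^sub>v (A *\<^sub>v x) = S *\<^sub>v (transpose_mat V *\<^sub>v x)"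
    using D(1,2) y assoc_mult_mat_vec[of "transpose_mat U" m m U m, OF _ _ y]
    by (simp add: full_svd_mult_vec[OF svd x] orthonormal_cols_def)
  then have "col U l \<bullet> (A *\<^sub>v x) = (S *\<^sub>v (transpose_mat V *\<^sub>v x)) $ l"
    using D(1) l by (metis carrier_matD(2) transpose_mult_vec_index)
  then show ?thesis
    using D l x diagonal_mult_vec_index[OF D(5,6), of "transpose_mat V *\<^sub>v x" l] by simp
qed

lemma full_svd_norm:
  assumes svd: "full_svd A U S V" "A \<in> carrier_mat m n" and x: "x \<in> carrier_vec n"
  shows "(A *\<^sub>v x) \<bullet> (A *\<^sub>v x) = (\<Sum>l<min m n. (S $$ (l,l))\<^sup>2 * (col V l \<bullet> x)\<^sup>2)"
proof -
  note D = full_svdD[OF svd]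
  have "(A *\<^sub>v x) \<bullet> (A *\<^sub>v x) = (\<Sum>l<m. (col U l \<bullet> (A *\<^sub>v x))\<^sup>2)"
    using parseval[OF D(2,1)] svd(2) x by simp
  also have "\<dots> = (\<Sum>l<min m n. (S $$ (l,l) * (col V l \<bullet> x))\<^sup>2)"
    using full_svd_coord[OF svd x] by (intro sum.mono_neutral_cong_right) auto
  finally show ?thesis by (simp add: power_mult_distrib)
qed

lemma full_svd_right_vector:
  assumes svd: "full_svd A U S V" "A \<in> carrier_mat m n" and j: "j < min m n"
  shows "A *\<^sub>v col V j = S $$ (j,j) \<cdot>\<^sub>v col U j"
proof -
  note D = full_svdD[OF svd]
  have "transpose_mat V *\<^sub>v col V j = unit_vec n j"
    using D(3,4) j by (intro eq_vecI) (auto simp: orthonormal_cols_iff unit_vec_def)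
  then have "S *\<^sub>v (transpose_mat V *\<^sub>v col V j) = S $$ (j,j) \<cdot>\<^sub>v unit_vec m j"
    using D(5,6) j by (intro eq_vecI) (auto simp: diagonal_mult_vec_index[OF D(5,6)] simp del: index_mult_mat_vec)
  moreover have "U *\<^sub>v unit_vec m j = col U j"
    using D(1) j by (intro eq_vecI) auto
  moreover have "col V j \<in> carrier_vec n" using D(3) j by auto
  ultimately show ?thesis
    using full_svd_mult_vec[OF svd, of "col V j"] mult_mat_vec[OF D(1), of "unit_vec m j"] by simp
qed

lemma full_svd_right_vector_norm:
  assumes svd: "full_svd A U S V" "A \<in> carrier_mat m n" and j: "j < min m n"
  shows "(A *\<^sub>v col V j) \<bullet> (A *\<^sub>v col V j) = (S $$ (j,j))\<^sup>2"
  using full_svdD[OF svd] j unfolding full_svd_right_vector[OF assms] scalar_prod_smult_self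
  by (simp add: orthonormal_cols_iff)

text \<open>Weights between 0 and 1 of total mass at most \<open>r\<close> do best when they are put on the \<open>r\<close> largest terms: compare
  each term with the \<open>r\<close>-th largest one.\<close>

lemma weighted_sum_le_sum_largest:
  fixes s d :: "nat \<Rightarrow> real"
  assumes s: "\<And>i j. i \<le> j \<Longrightarrow> j < p \<Longrightarrow> s j \<le> s i" "\<And>i. i < p \<Longrightarrow> 0 \<le> s i"
    and d: "\<And>i. i < p \<Longrightarrow> 0 \<le> d i" "\<And>i. i < p \<Longrightarrow> d i \<le> 1" "(\<Sum>i<p. d i) \<le> real r"
    and r: "r \<le> p"
  shows "(\<Sum>i<p. s i * d i) \<le> (\<Sum>i<r. s i)"
proof (cases "r = 0")
  case True
  then have "(\<Sum>i<p. d i) = 0" using d sum_nonneg[of "{..<p}" d] by force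
  then have "\<forall>i\<in>{..<p}. d i = 0" using d(1) by (subst (asm) sum_nonneg_eq_0_iff) auto
  then show ?thesis using True by simp
next
  case False
  define t where "t = s (r - 1)"
  have t: "0 \<le> t" using s(2) False r by (simp add: t_def)
  have split: "(\<Sum>i<p. f i) = (\<Sum>i<r. f i) + (\<Sum>i=r..<p. f i)" for f :: "nat \<Rightarrow> real"
    using r by (metis atLeast0LessThan le0 sum.atLeastLessThan_concat)
  have "(\<Sum>i<r. s i * (d i - 1)) \<le> (\<Sum>i<r. t * (d i - 1))"
    using False r d(2) s(1) by (intro sum_mono mult_right_mono_neg) (auto simp: t_def)
  moreover have "(\<Sum>i=r..<p. s i * d i) \<le> (\<Sum>i=r..<p. t * d i)"
    using False r d(1) s(1) by (intro sum_mono mult_right_mono) (auto simp: t_def)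
  ultimately have "(\<Sum>i<p. s i * d i) - (\<Sum>i<r. s i) \<le> t * ((\<Sum>i<p. d i) - r)"
    by (simp add: split algebra_simps sum_subtractf sum_distrib_left)
  also have "\<dots> \<le> 0" using t d(3) by (simp add: mult_nonneg_nonpos)
  finally show ?thesis by simp
qed

text \<open>Ky Fan's maximum principle. The mass \<open>\<Sum>\<^sub>j (v\<^sub>l \<bullet> y\<^sub>j)\<^sup>2\<close> that the system \<open>Y\<close> puts on the singular vector
  \<open>v\<^sub>l\<close> is at most 1 by Bessel, and the total mass is at most \<open>r\<close> by Parseval.\<close>

lemma ky_fan:
  assumes svd: "full_svd A U S V" "A \<in> carrier_mat m n"
    and Y: "orthonormal_cols Y" "Y \<in> carrier_mat n r" and r: "r \<le> min m n"
  shows "(\<Sum>j<r. (A *\<^sub>v col Y j) \<bullet> (A *\<^sub>v col Y j)) \<le> (\<Sum>l<r. (S $$ (l,l))\<^sup>2)"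
proof -
  note D = full_svdD[OF svd]
  let ?d = "\<lambda>l. \<Sum>j<r. (col V l \<bullet> col Y j)\<^sup>2"
  have "(\<Sum>j<r. (A *\<^sub>v col Y j) \<bullet> (A *\<^sub>v col Y j)) = (\<Sum>j<r. \<Sum>l<min m n. (S $$ (l,l))\<^sup>2 * (col V l \<bullet> col Y j)\<^sup>2)"
    using Y by (intro sum.cong refl full_svd_norm[OF svd]) auto
  also have "\<dots> = (\<Sum>l<min m n. (S $$ (l,l))\<^sup>2 * ?d l)"
    by (subst sum.swap) (simp add: sum_distrib_left)
  also have "\<dots> \<le> (\<Sum>l<r. (S $$ (l,l))\<^sup>2)"
  proof (rule weighted_sum_le_sum_largest[OF _ _ _ _ _ r])
    show "(S $$ (j,j))\<^sup>2 \<le> (S $$ (i,i))\<^sup>2" if "i \<le> j" "j < min m n" for i j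
      using D(8)[OF that(2)] D(9)[OF that] by (rule power_mono[rotated])
    show "?d l \<le> 1" if "l < min m n" for l
    proof -
      have "?d l = (\<Sum>j<r. (col Y j \<bullet> col V l)\<^sup>2)"
        using D(3) Y(2) by (intro sum.cong refl) (simp add: scalar_prod_comm_dim[of "col V l"])
      also have "\<dots> \<le> col V l \<bullet> col V l"
        using D(3) that by (intro bessel[OF Y]) auto
      also have "\<dots> = 1" using D(3,4) that by (simp add: orthonormal_cols_iff)
      finally show ?thesis .
    qed
    have "(\<Sum>l<min m n. ?d l) \<le> (\<Sum>l<n. ?d l)"
      by (intro sum_mono2) (auto simp: sum_nonneg)
    also have "\<dots> = (\<Sum>j<r. col Y j \<bullet> col Y j)"
      using Y by (subst sum.swap) (simp add: parseval[OF D(4,3)])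
    also have "\<dots> = r" using Y by (simp add: orthonormal_cols_iff)
    finally show "(\<Sum>l<min m n. ?d l) \<le> real r" .
  qed (auto simp: sum_nonneg)
  finally show ?thesis .
qed

text \<open>Fewer than \<open>k\<close> homogeneous equations in \<open>k\<close> unknowns: pad them with zero rows to a square matrix, which is
  singular.\<close>

lemma ex_nonzero_orthogonal_vec:
  fixes f :: "nat \<Rightarrow> real vec"
  assumes i: "i < k" and f: "\<And>l. l < i \<Longrightarrow> f l \<in> carrier_vec k"
  obtains a where "a \<in> carrier_vec k" "a \<noteq> 0\<^sub>v k" "\<And>l. l < i \<Longrightarrow> f l \<bullet> a = 0"
proof -
  define G where "G = mat k k (\<lambda>(l,j). if l < i then f l $ j else 0)"
  have G: "G \<in> carrier_mat k k" by (simp add: G_def)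
  have "transpose_mat G *\<^sub>v unit_vec k i = 0\<^sub>v k"
    using i by (intro eq_vecI) (auto simp: G_def)
  then have "det (transpose_mat G) = 0"
    using G i by (subst det_0_iff_vec_prod_zero_field[of _ k]) (auto intro!: exI[of _ "unit_vec k i"])
  then have "det G = 0" using det_transpose[OF G] by simp
  then obtain a where a: "a \<in> carrier_vec k" "a \<noteq> 0\<^sub>v k" "G *\<^sub>v a = 0\<^sub>v k"
    using det_0_iff_vec_prod_zero_field[OF G] by blast
  show thesis
  proof (rule that[OF a(1,2)])
    fix l assume l: "l < i"
    have "row G l = f l" using l i f[OF l] by (intro eq_vecI) (auto simp: G_def)
    then show "f l \<bullet> a = 0" using arg_cong[OF a(3), of "\<lambda>v. v $ l"] G l i by simp
  qed
qed

text \<open>One half of the min-max principle. A subspace of dimension \<open>i + 1\<close> contains a nonzero vector orthogonal to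
  \<open>v\<^sub>0, \<dots>, v\<^bsub>i-1\<^esub>\<close>, and \<open>A\<close> stretches such a vector by at most the singular value with index \<open>i\<close>.\<close>

lemma singular_value_ge_of_lower_bound:
  assumes svd: "full_svd A U S V" "A \<in> carrier_mat m n" and i: "i < min m n"
    and Y: "orthonormal_cols Y" "Y \<in> carrier_mat n (Suc i)"
    and c: "0 \<le> c" "\<And>a. a \<in> carrier_vec (Suc i) \<Longrightarrow>
      c\<^sup>2 * (a \<bullet> a) \<le> (A *\<^sub>v (Y *\<^sub>v a)) \<bullet> (A *\<^sub>v (Y *\<^sub>v a))"
  shows "c \<le> S $$ (i,i)"
proof -
  note D = full_svdD[OF svd]
  have fY: "transpose_mat Y *\<^sub>v col V l \<in> carrier_vec (Suc i)" for l
    using Y(2) by (intro carrier_vecI) simp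
  obtain a where a: "a \<in> carrier_vec (Suc i)" "a \<noteq> 0\<^sub>v (Suc i)"
    "\<And>l. l < i \<Longrightarrow> (transpose_mat Y *\<^sub>v col V l) \<bullet> a = 0"
    using ex_nonzero_orthogonal_vec[of i "Suc i" "\<lambda>l. transpose_mat Y *\<^sub>v col V l", OF lessI fY] by blast
  let ?x = "Y *\<^sub>v a"
  have x: "?x \<in> carrier_vec n" using Y a by simp
  have orth: "col V l \<bullet> ?x = 0" if "l < i" for l
  proof -
    have "col V l \<in> carrier_vec n" using D(3) by (intro carrier_vecI) simp
    then show ?thesis using a(3)[OF that] transpose_vec_mult_scalar[OF Y(2) a(1)] by simp
  qed
  have aa: "0 < a \<bullet> a"
    using a(1,2) scalar_prod_self_eq_0[of a] scalar_prod_self_nonneg[of a] by (auto simp: less_le)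
  have "c\<^sup>2 * (a \<bullet> a) \<le> (A *\<^sub>v ?x) \<bullet> (A *\<^sub>v ?x)" using c(2)[OF a(1)] .
  also have "\<dots> = (\<Sum>l<min m n. (S $$ (l,l))\<^sup>2 * (col V l \<bullet> ?x)\<^sup>2)"
    by (rule full_svd_norm[OF svd x])
  also have "\<dots> \<le> (\<Sum>l<min m n. (S $$ (i,i))\<^sup>2 * (col V l \<bullet> ?x)\<^sup>2)"
  proof (rule sum_mono)
    fix l assume l: "l \<in> {..<min m n}"
    show "(S $$ (l,l))\<^sup>2 * (col V l \<bullet> ?x)\<^sup>2 \<le> (S $$ (i,i))\<^sup>2 * (col V l \<bullet> ?x)\<^sup>2"
    proof (cases "l < i")
      case False
      then show ?thesis using l D(8,9) by (intro mult_right_mono power_mono) auto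
    qed (simp add: orth)
  qed
  also have "\<dots> \<le> (\<Sum>l<n. (S $$ (i,i))\<^sup>2 * (col V l \<bullet> ?x)\<^sup>2)"
    by (intro sum_mono2) auto
  also have "\<dots> = (S $$ (i,i))\<^sup>2 * (a \<bullet> a)"
    using parseval[OF D(4,3) x] orthonormal_cols_isometry[OF Y a(1)]
    by (simp flip: sum_distrib_left)
  finally have "c\<^sup>2 \<le> (S $$ (i,i))\<^sup>2" using aa by simp
  then show ?thesis using D(8)[OF i] by (rule power2_le_imp_le)
qed

text \<open>The span of \<open>v\<^sub>0, \<dots>, v\<^sub>i\<close> attains the bound of the preceding lemma; together they characterise the singular
  value without reference to a particular decomposition.\<close>

lemma full_svd_leading_right_bound:
  assumes svd: "full_svd A U S V" "A \<in> carrier_mat m n" and i: "i < min m n"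
    and a: "a \<in> carrier_vec (Suc i)"
  shows "(S $$ (i,i))\<^sup>2 * (a \<bullet> a)
    \<le> (A *\<^sub>v (leading_cols (Suc i) V *\<^sub>v a)) \<bullet> (A *\<^sub>v (leading_cols (Suc i) V *\<^sub>v a))"
proof -
  note D = full_svdD[OF svd]
  let ?Y = "leading_cols (Suc i) V"
  have Y: "?Y \<in> carrier_mat n (Suc i)" using D(3) by (simp add: leading_cols_def)
  have x: "?Y *\<^sub>v a \<in> carrier_vec n" using Y a by simp
  have colY: "col ?Y j = col V j" if "j < Suc i" for j
    using that i D(3) by (intro eq_vecI) (auto simp: leading_cols_def)
  have coord: "col V l \<bullet> (?Y *\<^sub>v a) = a $ l" if "l < Suc i" for l
  proof -
    have l: "l < n" using that i by simp
    have "col V l \<bullet> (?Y *\<^sub>v a) = (transpose_mat ?Y *\<^sub>v col V l) \<bullet> a"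
      using Y a D(3) l by (simp add: transpose_vec_mult_scalar[OF Y a])
    also have "transpose_mat ?Y *\<^sub>v col V l = unit_vec (Suc i) l"
      using Y D(3,4) that i colY by (intro eq_vecI) (auto simp: orthonormal_cols_iff unit_vec_def)
    finally show ?thesis using a that by simp
  qed
  have "(S $$ (i,i))\<^sup>2 * (a \<bullet> a) = (\<Sum>l<Suc i. (S $$ (i,i))\<^sup>2 * (col V l \<bullet> (?Y *\<^sub>v a))\<^sup>2)"
    using a by (simp add: scalar_prod_self_sum sum_distrib_left coord del: sum.lessThan_Suc)
  also have "\<dots> \<le> (\<Sum>l<Suc i. (S $$ (l,l))\<^sup>2 * (col V l \<bullet> (?Y *\<^sub>v a))\<^sup>2)"
    using i D(8)[OF i] D(9) by (intro sum_mono mult_right_mono power_mono) auto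
  also have "\<dots> \<le> (\<Sum>l<min m n. (S $$ (l,l))\<^sup>2 * (col V l \<bullet> (?Y *\<^sub>v a))\<^sup>2)"
    using i by (intro sum_mono2) auto
  finally show ?thesis by (simp add: full_svd_norm[OF svd x])
qed

lemma full_svd_values_unique:
  assumes svd: "full_svd A U S V" "full_svd A U' S' V'" and A: "A \<in> carrier_mat m n" and i: "i < min m n"
  shows "S $$ (i,i) = S' $$ (i,i)"
proof -
  have "S1 $$ (i,i) \<le> S2 $$ (i,i)" if s: "full_svd A U1 S1 V1" "full_svd A U2 S2 V2" for U1 S1 V1 U2 S2 V2
  proof (rule singular_value_ge_of_lower_bound[OF s(2) A i, of "leading_cols (Suc i) V1"])
    note D = full_svdD[OF s(1) A]
    show "orthonormal_cols (leading_cols (Suc i) V1)" "leading_cols (Suc i) V1 \<in> carrier_mat n (Suc i)"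
      using orthonormal_cols_leading_cols[OF D(4), of "Suc i"] D(3) i by (simp_all add: leading_cols_def)
    show "0 \<le> S1 $$ (i,i)" using D(8)[OF i] .
  qed (rule full_svd_leading_right_bound[OF s(1) A i])
  from this[OF svd] this[OF svd(2,1)] show ?thesis by simp
qed

text \<open>Uniqueness makes the definite description in the definition of \<open>sing_val\<close> meaningful.\<close>

lemma sing_val_eq:
  assumes "full_svd A U S V" "A \<in> carrier_mat m n" "i < min m n"
  shows "sing_val A (Suc i) = S $$ (i,i)"
  unfolding sing_val_def
proof (rule the_equality)
  show "\<exists>U' S' V'. full_svd A U' S' V' \<and> S $$ (i,i) = S' $$ (Suc i - 1, Suc i - 1)"
    using assms(1) by (intro exI[of _ U] exI[of _ S] exI[of _ V]) simp
  fix x assume "\<exists>U' S' V'. full_svd A U' S' V' \<and> x = S' $$ (Suc i - 1, Suc i - 1)"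
  then show "x = S $$ (i,i)" using full_svd_values_unique[OF _ assms] by auto
qed

section \<open>Existence of singular value decompositions\<close>

text \<open>The orthogonal matrices form a compact set, on which every weighted sum of the squared column norms of
  \<open>M Q\<close> attains its maximum. Topologically, matrices are treated as functions on pairs of indices,
  zero off the index square, with the product topology.\<close>

lemma ex_max_weighted_orthogonal:
  fixes M :: "real mat" and w :: "nat \<Rightarrow> real"
  assumes M: "M \<in> carrier_mat k s"
  obtains Q where "Q \<in> carrier_mat s s" "orthonormal_cols Q"
    "\<And>R. R \<in> carrier_mat s s \<Longrightarrow> orthonormal_cols R \<Longrightarrow>
      (\<Sum>j<s. w j * ((M *\<^sub>v col R j) \<bullet> (M *\<^sub>v col R j)))
        \<le> (\<Sum>j<s. w j * ((M *\<^sub>v col Q j) \<bullet> (M *\<^sub>v col Q j)))"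
proof -
  define K :: "(nat \<times> nat \<Rightarrow> real) set" where
    "K = (\<Pi>\<^sub>E p\<in>UNIV. if p \<in> {..<s} \<times> {..<s} then {-1..1} else {0})"
  define C :: "(nat \<times> nat \<Rightarrow> real) set" where
    "C = {f. \<forall>i<s. \<forall>j<s. (\<Sum>l<s. f (l,i) * f (l,j)) = (if i = j then 1 else 0)}"
  define obj :: "(nat \<times> nat \<Rightarrow> real) \<Rightarrow> real" where
    "obj f = (\<Sum>j<s. w j * (\<Sum>i<k. (\<Sum>l<s. M $$ (i,l) * f (l,j))\<^sup>2))" for f
  have coord: "continuous_on X (\<lambda>f::nat \<times> nat \<Rightarrow> real. f p)" for X p
    by (rule continuous_on_subset[OF continuous_on_product_coordinates subset_UNIV])
  have "compact K"
  proof -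
    have eq: "compact (Pi\<^sub>E UNIV T) \<longleftrightarrow> Pi\<^sub>E UNIV T = {} \<or> (\<forall>p. compact (T p))"
      for T :: "nat \<times> nat \<Rightarrow> real set"
      using compactin_PiE[of "\<lambda>_. euclideanreal" UNIV T]
      by (simp add: euclidean_product_topology del: PiE_UNIV_domain)
    show ?thesis unfolding K_def eq by simp
  qed
  moreover have "closed C"
    unfolding C_def by (intro closed_Collect_all closed_Collect_imp closed_Collect_eq open_Collect_const
      continuous_intros coord)
  ultimately have compact: "compact (K \<inter> C)" by (rule compact_Int_closed)
  have orth: "orthonormal_cols (mat s s f) \<longleftrightarrow> f \<in> C" for f
    by (auto simp: orthonormal_cols_iff C_def scalar_prod_def atLeast0LessThan)
  have obj: "obj f = (\<Sum>j<s. w j * ((M *\<^sub>v col (mat s s f) j) \<bullet> (M *\<^sub>v col (mat s s f) j)))" for f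
    using M by (simp add: obj_def scalar_prod_self_sum) (simp add: scalar_prod_def atLeast0LessThan)
  define ent :: "real mat \<Rightarrow> nat \<times> nat \<Rightarrow> real" where
    "ent R = (\<lambda>p. if p \<in> {..<s} \<times> {..<s} then R $$ p else 0)" for R
  have ent: "mat s s (ent R) = R" "ent R \<in> K \<inter> C" if R: "R \<in> carrier_mat s s" "orthonormal_cols R" for R
  proof -
    show *: "mat s s (ent R) = R" using R by (intro eq_matI) (auto simp: ent_def)
    have "\<bar>R $$ (l,j)\<bar> \<le> 1" if "l < s" "j < s" for l j
    proof -
      have "(R $$ (l,j))\<^sup>2 \<le> (\<Sum>i<s. (R $$ (i,j))\<^sup>2)"
        using that by (intro member_le_sum) auto
      also have "\<dots> = col R j \<bullet> col R j" using R that by (simp add: scalar_prod_self_sum)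
      also have "\<dots> = 1" using R that by (simp add: orthonormal_cols_iff)
      finally show ?thesis by (simp add: abs_square_le_1)
    qed
    then have "ent R \<in> K" by (auto simp: K_def ent_def abs_le_iff)
    moreover have "ent R \<in> C" using orth[of "ent R"] * R by simp
    ultimately show "ent R \<in> K \<inter> C" by simp
  qed
  have "ent (1\<^sub>m s) \<in> K \<inter> C" by (intro ent) (auto simp: orthonormal_cols_def)
  then have "K \<inter> C \<noteq> {}" by blast
  moreover have "continuous_on (K \<inter> C) obj"
    unfolding obj_def by (intro continuous_intros coord)
  ultimately obtain f where f: "f \<in> K \<inter> C" "\<And>g. g \<in> K \<inter> C \<Longrightarrow> obj g \<le> obj f"
    using continuous_attains_sup[OF compact] by metis
  show thesis
  proof (rule that[of "mat s s f"])
    show "mat s s f \<in> carrier_mat s s" by simp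
    show "orthonormal_cols (mat s s f)" using f(1) orth by simp
    fix R :: "real mat" assume R: "R \<in> carrier_mat s s" "orthonormal_cols R"
    show "(\<Sum>j<s. w j * ((M *\<^sub>v col R j) \<bullet> (M *\<^sub>v col R j)))
      \<le> (\<Sum>j<s. w j * ((M *\<^sub>v col (mat s s f) j) \<bullet> (M *\<^sub>v col (mat s s f) j)))"
      using f(2)[OF ent(2)[OF R]] by (simp only: obj ent(1)[OF R])
  qed
qed

text \<open>First-order condition at the angle 0, without derivatives: \<open>\<alpha>\<close>, \<open>\<beta>\<close>, \<open>\<gamma>\<close> are the entries of a symmetric
  \<open>2 \<times> 2\<close> matrix whose quadratic form has its maximum over the unit circle at the first basis vector.\<close>

lemma rotation_max_imp_diagonal:
  fixes \<alpha> \<beta> \<gamma> :: real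
  assumes max: "\<And>c t. c\<^sup>2 + t\<^sup>2 = 1 \<Longrightarrow> c\<^sup>2 * \<alpha> + 2 * c * t * \<gamma> + t\<^sup>2 * \<beta> \<le> \<alpha>"
  shows "\<gamma> = 0" "\<beta> \<le> \<alpha>"
proof -
  show le: "\<beta> \<le> \<alpha>" using max[of 0 1] by simp
  \<comment> \<open>Evaluate at slope \<open>u\<close>; this value makes \<open>2 u \<gamma> \<le> u\<^sup>2 d\<close> fail unless \<open>u = 0\<close>.\<close>
  define d u where "d = \<alpha> - \<beta>" and "u = \<gamma> / (d + 1)"
  have d: "0 \<le> d" using le by (simp add: d_def)
  define r where "r = sqrt (1 + u\<^sup>2)"
  have r: "r\<^sup>2 = 1 + u\<^sup>2" "r > 0" by (simp_all add: r_def add_pos_nonneg)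
  have "(1/r)\<^sup>2 * \<alpha> + 2 * (1/r) * (u/r) * \<gamma> + (u/r)\<^sup>2 * \<beta> \<le> \<alpha>"
    using r(1) by (intro max) (simp add: power_divide add_pos_nonneg[THEN less_imp_neq, symmetric] flip: add_divide_distrib)
  then have "r\<^sup>2 * ((1/r)\<^sup>2 * \<alpha> + 2 * (1/r) * (u/r) * \<gamma> + (u/r)\<^sup>2 * \<beta>) \<le> r\<^sup>2 * \<alpha>"
    by (rule mult_left_mono) simp
  then have "\<alpha> + 2 * u * \<gamma> + u\<^sup>2 * \<beta> \<le> (1 + u\<^sup>2) * \<alpha>"
    using r by (simp add: algebra_simps power_divide power2_eq_square)
  then have "2 * u * \<gamma> \<le> u\<^sup>2 * d" by (simp add: d_def algebra_simps)
  moreover have "\<gamma> = u * (d + 1)" using d by (simp add: u_def)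
  ultimately have "u\<^sup>2 * (d + 2) \<le> 0" by (simp add: algebra_simps power2_eq_square)
  then have "u\<^sup>2 \<le> 0" using d by (simp add: mult_le_0_iff)
  then have "u = 0" by simp
  then show "\<gamma> = 0" using d by (simp add: u_def)
qed

text \<open>The essential part of a singular value decomposition: an orthonormal basis whose image under \<open>M\<close> is orthogonal,
  ordered by decreasing norm. Maximise \<open>\<Sum>\<^sub>j (s - j) \<parallel>M q\<^sub>j\<parallel>\<^sup>2\<close>. A rotation in the plane of two columns
  preserves \<open>\<parallel>M q\<^sub>a\<parallel>\<^sup>2 + \<parallel>M q\<^sub>b\<parallel>\<^sup>2\<close>; as the weights decrease strictly, no rotation can increase \<open>\<parallel>M q\<^sub>a\<parallel>\<close>
  if \<open>a < b\<close>.\<close>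

lemma ex_orthogonal_image_basis:
  fixes M :: "real mat"
  assumes M: "M \<in> carrier_mat k s"
  obtains Q where "Q \<in> carrier_mat s s" "orthonormal_cols Q"
    "\<And>a b. a < b \<Longrightarrow> b < s \<Longrightarrow> (M *\<^sub>v col Q a) \<bullet> (M *\<^sub>v col Q b) = 0"
    "\<And>a b. a \<le> b \<Longrightarrow> b < s \<Longrightarrow> (M *\<^sub>v col Q b) \<bullet> (M *\<^sub>v col Q b) \<le> (M *\<^sub>v col Q a) \<bullet> (M *\<^sub>v col Q a)"
proof -
  let ?w = "\<lambda>j. real s - real j"
  let ?obj = "\<lambda>R. \<Sum>j<s. ?w j * ((M *\<^sub>v col R j) \<bullet> (M *\<^sub>v col R j))"
  obtain Q where Q: "Q \<in> carrier_mat s s" "orthonormal_cols Q"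
    and max: "\<And>R. R \<in> carrier_mat s s \<Longrightarrow> orthonormal_cols R \<Longrightarrow> ?obj R \<le> ?obj Q"
    using ex_max_weighted_orthogonal[OF M, of ?w] by blast
  have onb: "col Q i \<bullet> col Q j = (if i = j then 1 else 0)" if "i < s" "j < s" for i j
    using Q that by (simp add: orthonormal_cols_iff)
  have colQ: "col Q j \<in> carrier_vec s" if "j < s" for j using Q(1) by (intro carrier_vecI) simp
  have key: "c\<^sup>2 * ((M *\<^sub>v col Q a) \<bullet> (M *\<^sub>v col Q a)) + 2 * c * t * ((M *\<^sub>v col Q a) \<bullet> (M *\<^sub>v col Q b))
      + t\<^sup>2 * ((M *\<^sub>v col Q b) \<bullet> (M *\<^sub>v col Q b)) \<le> (M *\<^sub>v col Q a) \<bullet> (M *\<^sub>v col Q a)"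
    if ab: "a < b" "b < s" and ct: "c\<^sup>2 + t\<^sup>2 = 1" for a b c t
  proof -
    let ?x = "M *\<^sub>v col Q a" and ?y = "M *\<^sub>v col Q b"
    have x: "?x \<in> carrier_vec k" and y: "?y \<in> carrier_vec k" using M by (auto intro!: carrier_vecI)
    define R where "R = mat s s (\<lambda>(l,j). if j = a then c * Q $$ (l,a) + t * Q $$ (l,b)
      else if j = b then c * Q $$ (l,b) - t * Q $$ (l,a) else Q $$ (l,j))"
    have R: "R \<in> carrier_mat s s" by (simp add: R_def)
    have cols: "col R a = c \<cdot>\<^sub>v col Q a + t \<cdot>\<^sub>v col Q b" "col R b = c \<cdot>\<^sub>v col Q b - t \<cdot>\<^sub>v col Q a"
      "\<And>j. j < s \<Longrightarrow> j \<noteq> a \<Longrightarrow> j \<noteq> b \<Longrightarrow> col R j = col Q j"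
      using ab Q(1) by (auto simp: R_def intro!: eq_vecI)
    have as: "a < s" using ab by simp
    note lin = scalar_prod_add_distrib[of _ s] add_scalar_prod_distrib[of _ s]
      scalar_prod_minus_distrib[of _ s] minus_scalar_prod_distrib[of _ s]
    have "orthonormal_cols R"
      unfolding orthonormal_cols_iff
    proof (intro allI impI)
      fix i j assume "i < dim_col R" "j < dim_col R"
      then have ij: "i < s" "j < s" using R by auto
      note [simp] = colQ onb ij as ab(2)
      have ne: "a \<noteq> b" using ab by simp
      consider "i = a" | "i = b" | "i \<noteq> a" "i \<noteq> b" by blast
      then show "col R i \<bullet> col R j = (if i = j then 1 else 0)"
      proof cases
        case 1
        consider "j = a" | "j = b" | "j \<noteq> a" "j \<noteq> b" by blast
        then show ?thesis using 1 ne ct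
          by cases (simp_all add: cols lin power2_eq_square)
      next
        case 2
        consider "j = a" | "j = b" | "j \<noteq> a" "j \<noteq> b" by blast
        then show ?thesis using 2 ne ct
          by cases (simp_all add: cols lin power2_eq_square)
      next
        case 3
        consider "j = a" | "j = b" | "j \<noteq> a" "j \<noteq> b" by blast
        then show ?thesis using 3 ne ct
          by cases (simp_all add: cols lin power2_eq_square)
      qed
    qed
    from max[OF R this] have le: "?obj R \<le> ?obj Q" .
    have img: "M *\<^sub>v col R a = c \<cdot>\<^sub>v ?x + t \<cdot>\<^sub>v ?y" "M *\<^sub>v col R b = c \<cdot>\<^sub>v ?y - t \<cdot>\<^sub>v ?x"
      using M colQ as ab(2)
      by (simp_all add: cols mult_add_distrib_mat_vec[of _ k s] mult_minus_distrib_mat_vec[of _ k s] mult_mat_vec[of _ k s])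
    note lin = scalar_prod_add_distrib[of _ k] add_scalar_prod_distrib[of _ k]
      scalar_prod_minus_distrib[of _ k] minus_scalar_prod_distrib[of _ k]
    have yx: "?y \<bullet> ?x = ?x \<bullet> ?y" using x y by (rule comm_scalar_prod[of _ k, rotated])
    have na: "(M *\<^sub>v col R a) \<bullet> (M *\<^sub>v col R a) = c\<^sup>2 * (?x \<bullet> ?x) + 2 * c * t * (?x \<bullet> ?y) + t\<^sup>2 * (?y \<bullet> ?y)"
      using x y unfolding img by (simp add: lin yx power2_eq_square algebra_simps)
    have nb: "(M *\<^sub>v col R b) \<bullet> (M *\<^sub>v col R b) = c\<^sup>2 * (?y \<bullet> ?y) - 2 * c * t * (?x \<bullet> ?y) + t\<^sup>2 * (?x \<bullet> ?x)"
      using x y unfolding img by (simp add: lin yx power2_eq_square algebra_simps)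
    have split: "(\<Sum>j<s. f j) = f a + f b + (\<Sum>j\<in>{..<s} - {a,b}. f j)" for f :: "nat \<Rightarrow> real"
    proof -
      have "{..<s} = insert a (insert b ({..<s} - {a,b}))" using ab by auto
      then have "(\<Sum>j<s. f j) = (\<Sum>j\<in>insert a (insert b ({..<s} - {a,b})). f j)" by (rule arg_cong)
      then show ?thesis using ab by simp
    qed
    have "(\<Sum>j\<in>{..<s} - {a,b}. ?w j * ((M *\<^sub>v col R j) \<bullet> (M *\<^sub>v col R j)))
      = (\<Sum>j\<in>{..<s} - {a,b}. ?w j * ((M *\<^sub>v col Q j) \<bullet> (M *\<^sub>v col Q j)))"
      by (intro sum.cong refl) (simp add: cols)
    with le have le': "?w a * ((M *\<^sub>v col R a) \<bullet> (M *\<^sub>v col R a)) + ?w b * ((M *\<^sub>v col R b) \<bullet> (M *\<^sub>v col R b))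
      \<le> ?w a * (?x \<bullet> ?x) + ?w b * (?y \<bullet> ?y)"
      by (simp add: split)
    define g where "g = c\<^sup>2 * (?x \<bullet> ?x) + 2 * c * t * (?x \<bullet> ?y) + t\<^sup>2 * (?y \<bullet> ?y)"
    have "c\<^sup>2 * (?y \<bullet> ?y) - 2 * c * t * (?x \<bullet> ?y) + t\<^sup>2 * (?x \<bullet> ?x) = (c\<^sup>2 + t\<^sup>2) * (?x \<bullet> ?x + ?y \<bullet> ?y) - g"
      by (simp add: g_def algebra_simps)
    then have "?w a * g + ?w b * (?x \<bullet> ?x + ?y \<bullet> ?y - g) \<le> ?w a * (?x \<bullet> ?x) + ?w b * (?y \<bullet> ?y)"
      using le' unfolding na nb g_def[symmetric] by (simp add: ct)
    then have "(?w a - ?w b) * (g - ?x \<bullet> ?x) \<le> 0" by (simp add: algebra_simps)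
    moreover have "?w a - ?w b > 0" using ab by simp
    ultimately have "g \<le> ?x \<bullet> ?x" by (simp add: mult_le_0_iff)
    then show ?thesis by (simp add: g_def)
  qed
  show thesis
  proof (rule that[OF Q])
    show "(M *\<^sub>v col Q a) \<bullet> (M *\<^sub>v col Q b) = 0" if "a < b" "b < s" for a b
      using rotation_max_imp_diagonal(1)[OF key[OF that]] .
    show "(M *\<^sub>v col Q b) \<bullet> (M *\<^sub>v col Q b) \<le> (M *\<^sub>v col Q a) \<bullet> (M *\<^sub>v col Q a)" if "a \<le> b" "b < s" for a b
      using rotation_max_imp_diagonal(2)[OF key, of a b] that by (cases "a = b") auto
  qed
qed

text \<open>With full row rank, exactly the first \<open>k\<close> vectors of the orthogonal image are nonzero. Normalised, they
  already form a basis of the codomain, so that the left factor needs no completion.\<close>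

lemma full_row_rank_svd:
  fixes M :: "real mat"
  assumes M: "M \<in> carrier_mat k s"
    and inj: "\<And>p. p \<in> carrier_vec k \<Longrightarrow> transpose_mat M *\<^sub>v p = 0\<^sub>v s \<Longrightarrow> p = 0\<^sub>v k"
  obtains U S V where "full_svd M U S V" "k \<le> s" "\<And>i. i < k \<Longrightarrow> 0 < S $$ (i,i)"
proof -
  obtain Q where Q: "Q \<in> carrier_mat s s" "orthonormal_cols Q"
    and orth: "\<And>a b. a < b \<Longrightarrow> b < s \<Longrightarrow> (M *\<^sub>v col Q a) \<bullet> (M *\<^sub>v col Q b) = 0"
    and mono: "\<And>a b. a \<le> b \<Longrightarrow> b < s \<Longrightarrow>
      (M *\<^sub>v col Q b) \<bullet> (M *\<^sub>v col Q b) \<le> (M *\<^sub>v col Q a) \<bullet> (M *\<^sub>v col Q a)"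
    using ex_orthogonal_image_basis[OF M] by blast
  define b where "b j = M *\<^sub>v col Q j" for j
  have b: "b j \<in> carrier_vec k" for j using M by (intro carrier_vecI) (simp add: b_def)
  have orth': "b i \<bullet> b j = 0" if "i \<noteq> j" "i < s" "j < s" for i j
    using that orth[of i j] orth[of j i] scalar_prod_comm_dim[of "b i" "b j"] b
    by (cases "i < j") (auto simp: b_def)
  have Qt: "orthonormal_cols (transpose_mat Q)" "transpose_mat Q \<in> carrier_mat s s"
    using orthonormal_cols_transpose[OF Q(2,1)] Q(1) by auto
  \<comment> \<open>Fewer than \<open>k\<close> nonzero image vectors would leave a nonzero \<open>p\<close> orthogonal to the range of \<open>M\<close>.\<close>
  have not_all: False if i: "i < k" and z: "\<And>j. i \<le> j \<Longrightarrow> j < s \<Longrightarrow> b j \<bullet> b j = 0" for i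
  proof -
    obtain p where p: "p \<in> carrier_vec k" "p \<noteq> 0\<^sub>v k" "\<And>l. l < i \<Longrightarrow> b l \<bullet> p = 0"
      using ex_nonzero_orthogonal_vec[of i k b, OF i b] by blast
    have Mp: "transpose_mat M *\<^sub>v p \<in> carrier_vec s" using M p by simp
    have z0: "b j \<bullet> p = 0" if "j < s" for j
    proof (cases "j < i")
      case False
      then have "b j = 0\<^sub>v k" using z[of j] that scalar_prod_self_eq_0[OF _ b] by simp
      then show ?thesis using p(1) by simp
    qed (rule p(3))
    have "col Q j \<bullet> (transpose_mat M *\<^sub>v p) = 0" if "j < s" for j
    proof -
      have cq: "col Q j \<in> carrier_vec s" using Q by (intro carrier_vecI) simp
      show ?thesis using z0[OF that] mult_vec_scalar_prod[OF M cq p(1)] by (simp add: b_def)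
    qed
    then have "(transpose_mat M *\<^sub>v p) \<bullet> (transpose_mat M *\<^sub>v p) = 0"
      unfolding parseval[OF Q(2,1) Mp, symmetric] by simp
    then have "transpose_mat M *\<^sub>v p = 0\<^sub>v s" using Mp by (rule scalar_prod_self_eq_0)
    then show False using inj p by blast
  qed
  \<comment> \<open>For \<open>i = s\<close> the hypothesis on the remaining image vectors is vacuous.\<close>
  have ks: "k \<le> s" using not_all[of s] by force
  have pos: "0 < b j \<bullet> b j" if "j < k" for j
  proof (rule ccontr)
    assume "\<not> 0 < b j \<bullet> b j"
    then have "b j \<bullet> b j = 0" using scalar_prod_self_nonneg[of "b j"] by linarith
    then have "b l \<bullet> b l = 0" if "j \<le> l" "l < s" for l
      using mono[OF that, folded b_def] \<open>b j \<bullet> b j = 0\<close> scalar_prod_self_nonneg[of "b l"] by linarith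
    then show False using not_all[OF that] by blast
  qed
  define P where "P = mat k k (\<lambda>(i,j). b j $ i / vec_norm2 (b j))"
  have P: "P \<in> carrier_mat k k" by (simp add: P_def)
  have norm_pos: "0 < vec_norm2 (b j)" if "j < k" for j using pos[OF that] by (simp add: vec_norm2_def)
  have colP: "col P j = (1 / vec_norm2 (b j)) \<cdot>\<^sub>v b j" if "j < k" for j
    using that b[of j] by (intro eq_vecI) (auto simp: P_def)
  have "orthonormal_cols P"
    unfolding orthonormal_cols_iff
  proof (intro allI impI)
    fix i j assume "i < dim_col P" "j < dim_col P"
    then have ij: "i < k" "j < k" using P by auto
    have "col P i \<bullet> col P j = (b i \<bullet> b j) / (vec_norm2 (b i) * vec_norm2 (b j))"
      using ij b[of i] b[of j] by (simp add: colP)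
    also have "\<dots> = (if i = j then 1 else 0)"
      using ij ks orth'[of i j] norm_pos[of i] vec_norm2_square[of "b i"]
      by (auto simp: power2_eq_square)
    finally show "col P i \<bullet> col P j = (if i = j then 1 else 0)" .
  qed
  have zero: "b j = 0\<^sub>v k" if "k \<le> j" "j < s" for j
  proof -
    have "col P l \<bullet> b j = 0" if "l < k" for l
      using that \<open>k \<le> j\<close> \<open>j < s\<close> b[of l] b[of j] orth'[of l j] by (simp add: colP)
    then have "b j \<bullet> b j = 0"
      using parseval[OF \<open>orthonormal_cols P\<close> P b[of j]] by simp
    then show ?thesis using b by (rule scalar_prod_self_eq_0)
  qed
  define S where "S = mat k s (\<lambda>(i,j). if i = j then vec_norm2 (b j) else 0)"
  have S: "S \<in> carrier_mat k s" by (simp add: S_def)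
  have "M * Q = P * S"
  proof (rule eq_matI)
    show "dim_row (M * Q) = dim_row (P * S)" "dim_col (M * Q) = dim_col (P * S)"
      using M Q P S by auto
    fix i j assume "i < dim_row (P * S)" "j < dim_col (P * S)"
    then have ij: "i < k" "j < s" using P S by auto
    have "(P * S) $$ (i,j) = (\<Sum>l<k. P $$ (i,l) * S $$ (l,j))"
      using P S ij by (simp add: scalar_prod_def atLeast0LessThan)
    also have "\<dots> = (\<Sum>l<k. if l = j then P $$ (i,j) * vec_norm2 (b j) else 0)"
      using ij by (intro sum.cong refl) (auto simp: S_def)
    also have "\<dots> = (if j < k then P $$ (i,j) * vec_norm2 (b j) else 0)"
      by (simp add: sum.delta)
    also have "\<dots> = b j $ i"
      using ij norm_pos[of j] zero[of j] by (auto simp: P_def)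
    also have "\<dots> = (M * Q) $$ (i,j)" using M Q ij by (simp add: b_def)
    finally show "(M * Q) $$ (i,j) = (P * S) $$ (i,j)" by simp
  qed
  moreover have "M * Q * transpose_mat Q = M"
    using M Q Qt assoc_mult_mat[OF M Q(1) Qt(2)] by (simp add: orthonormal_cols_def)
  ultimately have "M = P * S * transpose_mat Q" by simp
  moreover have "diagonal_mat S" by (auto simp: S_def diagonal_mat_def)
  moreover have diag: "S $$ (i,i) = vec_norm2 (b i)" if "i < k" for i using that ks by (simp add: S_def)
  moreover have "vec_norm2 (b j) \<le> vec_norm2 (b i)" if "i \<le> j" "j < k" for i j
    using that ks mono[of i j] by (simp add: vec_norm2_def b_def)
  ultimately have "full_svd M P S Q"
    using M P Q S \<open>orthonormal_cols P\<close> by (auto simp: full_svd_def simp del: assoc_mult_mat)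
  then show thesis using ks norm_pos diag by (intro that) auto
qed

section \<open>The pseudoinverse of a matrix of full row rank\<close>

text \<open>The Penrose equations have at most one solution: \<open>M Y = M Z\<close> and \<open>Y M = Z M\<close> by symmetry, whence
  \<open>Y = Y M Y = Z M Z = Z\<close>.\<close>

lemma pinv_eqI:
  assumes M: "M \<in> carrier_mat k s" and Y: "Y \<in> carrier_mat s k"
    and p: "M * Y * M = M" "Y * M * Y = Y" "transpose_mat (M * Y) = M * Y" "transpose_mat (Y * M) = Y * M"
  shows "pinv M = Y"
  unfolding pinv_def
proof (rule the_equality)
  fix Z assume "Z \<in> carrier_mat (dim_col M) (dim_row M) \<and> M * Z * M = M \<and> Z * M * Z = Z \<and>
     transpose_mat (M * Z) = M * Z \<and> transpose_mat (Z * M) = Z * M"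
  then have Z: "Z \<in> carrier_mat s k" and q: "M * Z * M = M" "Z * M * Z = Z"
    "transpose_mat (M * Z) = M * Z" "transpose_mat (Z * M) = Z * M" using M by auto
  have MY: "M * Y \<in> carrier_mat k k" "M * Z \<in> carrier_mat k k" "Y * M \<in> carrier_mat s s" "Z * M \<in> carrier_mat s s"
    using M Y Z by auto
  have "M * Y = M * Z * M * Y" using q(1) by simp
  also have "\<dots> = M * Z * (M * Y)" using M Y Z by (intro assoc_mult_mat) auto
  also have "\<dots> = transpose_mat (M * Z) * transpose_mat (M * Y)" using p(3) q(3) by simp
  also have "\<dots> = transpose_mat (M * Y * (M * Z))" by (rule transpose_mult[OF MY(1,2), symmetric])
  also have "M * Y * (M * Z) = M * Y * M * Z" using M Y Z by (intro assoc_mult_mat[symmetric]) auto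
  also have "\<dots> = M * Z" using p(1) by simp
  finally have 1: "M * Y = M * Z" using q(3) by simp
  have "Y * M = Y * (M * Z * M)" using q(1) by simp
  also have "\<dots> = Y * (M * (Z * M))" using assoc_mult_mat[OF M Z M] by simp
  also have "\<dots> = Y * M * (Z * M)" using assoc_mult_mat[OF Y M MY(4)] by simp
  also have "\<dots> = transpose_mat (Y * M) * transpose_mat (Z * M)" using p(4) q(4) by simp
  also have "\<dots> = transpose_mat (Z * M * (Y * M))" by (rule transpose_mult[OF MY(4,3), symmetric])
  also have "Z * M * (Y * M) = Z * (M * (Y * M))" by (rule assoc_mult_mat[OF Z M MY(3)])
  also have "M * (Y * M) = M" using assoc_mult_mat[OF M Y M] p(1) by simp
  finally have 2: "Y * M = Z * M" using q(4) by simp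
  have "Z = Z * M * Z" using q(2) by simp
  also have "\<dots> = Y * M * Z" using 2 by simp
  also have "\<dots> = Y * (M * Y)" using assoc_mult_mat[OF Y M Z] 1 by simp
  also have "\<dots> = Y" using assoc_mult_mat[OF Y M Y] p(2) by simp
  finally show "Z = Y" .
qed (use assms in auto)

text \<open>The Gram matrix \<open>M M\<^sup>T\<close> is invertible, because \<open>p \<bullet> M M\<^sup>T p = \<parallel>M\<^sup>T p\<parallel>\<^sup>2\<close>, and \<open>M\<^sup>T (M M\<^sup>T)\<^sup>-\<^sup>1\<close>
  satisfies the Penrose equations. It is in particular a right inverse of \<open>M\<close>.\<close>

lemma full_row_rank_pinv:
  fixes M :: "real mat"
  assumes M: "M \<in> carrier_mat k s"
    and inj: "\<And>p. p \<in> carrier_vec k \<Longrightarrow> transpose_mat M *\<^sub>v p = 0\<^sub>v s \<Longrightarrow> p = 0\<^sub>v k"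
  obtains B where "B \<in> carrier_mat k k" "B * (M * transpose_mat M) = 1\<^sub>m k"
    "M * transpose_mat M * B = 1\<^sub>m k" "pinv M = transpose_mat M * B"
proof -
  let ?G = "M * transpose_mat M"
  have Mt: "transpose_mat M \<in> carrier_mat s k" using M by simp
  have G: "?G \<in> carrier_mat k k" using M by simp
  have "det ?G \<noteq> 0"
  proof
    assume "det ?G = 0"
    then obtain p where p: "p \<in> carrier_vec k" "p \<noteq> 0\<^sub>v k" "?G *\<^sub>v p = 0\<^sub>v k"
      using det_0_iff_vec_prod_zero_field[OF G] by blast
    have Mp: "transpose_mat M *\<^sub>v p \<in> carrier_vec s" using M p by simp
    have "(transpose_mat M *\<^sub>v p) \<bullet> (transpose_mat M *\<^sub>v p) = p \<bullet> (?G *\<^sub>v p)"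
      using transpose_vec_mult_scalar[OF M Mp p(1)] assoc_mult_mat_vec[OF M Mt p(1)] by simp
    then have "(transpose_mat M *\<^sub>v p) \<bullet> (transpose_mat M *\<^sub>v p) = 0" using p by simp
    then have "transpose_mat M *\<^sub>v p = 0\<^sub>v s" using Mp by (rule scalar_prod_self_eq_0)
    then show False using inj p by blast
  qed
  then obtain B where B: "B \<in> carrier_mat k k" "B * ?G = 1\<^sub>m k" "?G * B = 1\<^sub>m k"
    using det_non_zero_imp_unit[OF G] unfolding Units_def ring_mat_def by auto
  have Gs: "transpose_mat ?G = ?G" using transpose_mult[OF M Mt] by simp
  \<comment> \<open>Needed for the symmetry of \<open>M\<^sup>T B M\<close>.\<close>
  have Bs: "transpose_mat B = B"
  proof -
    have Bt: "transpose_mat B \<in> carrier_mat k k" using B by simp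
    have "transpose_mat B * ?G = 1\<^sub>m k" using transpose_mult[OF G B(1)] B(3) Gs by simp
    then have "transpose_mat B * ?G * B = B" using B(1) by simp
    then show ?thesis using assoc_mult_mat[OF Bt G B(1)] B(3) Bt by simp
  qed
  let ?Y = "transpose_mat M * B"
  have Y: "?Y \<in> carrier_mat s k" using Mt B by simp
  have MY: "M * ?Y = 1\<^sub>m k" using assoc_mult_mat[OF M Mt B(1)] B(3) by simp
  have BM: "B * M \<in> carrier_mat k s" using B M by simp
  have YM: "?Y * M = transpose_mat M * (B * M)" using assoc_mult_mat[OF Mt B(1) M] .
  have "pinv M = ?Y"
  proof (rule pinv_eqI[OF M Y])
    show "M * ?Y * M = M" using MY M by simp
    show "?Y * M * ?Y = ?Y" using assoc_mult_mat[OF Y M Y] MY right_mult_one_mat[OF Y] by simp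
    show "transpose_mat (M * ?Y) = M * ?Y" using MY by simp
    have "transpose_mat (?Y * M) = transpose_mat M * transpose_mat ?Y" using transpose_mult[OF Y M] .
    also have "transpose_mat ?Y = B * M" using transpose_mult[OF Mt B(1)] Bs by simp
    finally show "transpose_mat (?Y * M) = ?Y * M" using YM by simp
  qed
  then show thesis using that[OF B] by blast
qed

lemma (in vec_space) rank_eq_card_indpt_subset:
  assumes "A \<in> carrier_mat n nc"
  obtains T where "T \<subseteq> set (cols A)" "finite T" "lin_indpt T" "card T = rank A"
proof -
  obtain T where T: "maximal T (\<lambda>T. T \<subseteq> set (cols A) \<and> lin_indpt T)"
    using maximal_exists[of "(\<lambda>T. T \<subseteq> set (cols A) \<and> lin_indpt T)" "card (set (cols A))" "{}"]
    by (meson List.finite_set card_mono empty_iff empty_subsetI finite_lin_indpt2 rev_finite_subset)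
  then have "T \<subseteq> set (cols A)" "lin_indpt T" by (auto simp: maximal_def)
  moreover from this have "finite T" using finite_subset by blast
  ultimately show thesis using that rank_card_indpt[OF assms T] by simp
qed

lemma mat_rank_le:
  assumes "M \<in> carrier_mat k s"
  shows "mat_rank M \<le> min k s"
proof -
  interpret vec_space "TYPE(real)" k .
  obtain T where T: "T \<subseteq> set (cols M)" "finite T" "lin_indpt T" "card T = rank M"
    using rank_eq_card_indpt_subset[OF assms] by blast
  have "T \<subseteq> carrier_vec k" using T(1) cols_dim[of M] assms by auto
  then have "card T \<le> dim" using li_le_dim(2)[OF fin_dim _ T(3)] by simp
  then show ?thesis using T(4) rank_le_nc[OF assms] assms dim_is_n by auto
qed

text \<open>Full row rank in the form in which it is used: if the columns of \<open>M\<close> span the whole space, only the zero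
  vector is orthogonal to all of them.\<close>

lemma full_row_rank_transpose_inj:
  fixes M :: "real mat"
  assumes M: "M \<in> carrier_mat k s" and rank: "mat_rank M = k"
    and p: "p \<in> carrier_vec k" "transpose_mat M *\<^sub>v p = 0\<^sub>v s"
  shows "p = 0\<^sub>v k"
proof -
  interpret vec_space "TYPE(real)" k .
  obtain T where T: "T \<subseteq> set (cols M)" "finite T" "lin_indpt T" "card T = rank M"
    using rank_eq_card_indpt_subset[OF M] by blast
  have sub: "set (cols M) \<subseteq> carrier_vec k" using M cols_dim[of M] by simp
  have "basis T"
    using T sub rank M dim_is_n by (intro dim_li_is_basis fin_dim) auto
  then have "span T = carrier_vec k" by (simp add: basis_def)
  moreover have "span T \<subseteq> span (set (cols M))" using span_is_monotone[OF T(1)] .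
  ultimately have "carrier_vec k \<subseteq> col_space M" by (simp add: col_space_def)
  then obtain x where x: "x \<in> carrier_vec s" "M *\<^sub>v x = p" using col_space_eq[OF M] p(1) M by auto
  have "p \<bullet> p = (transpose_mat M *\<^sub>v p) \<bullet> x" using transpose_vec_mult_scalar[OF M x(1) p(1)] x(2) by simp
  also have "\<dots> = 0" using p(2) x(1) by simp
  finally show ?thesis using p(1) by (rule scalar_prod_self_eq_0)
qed

section \<open>Leading and trailing columns\<close>

lemma leading_cols_carrier: "M \<in> carrier_mat m n \<Longrightarrow> leading_cols i M \<in> carrier_mat m i"
  by (simp add: leading_cols_def)

lemma trailing_cols_carrier: "M \<in> carrier_mat m n \<Longrightarrow> trailing_cols i M \<in> carrier_mat m (n - i)"
  by (simp add: trailing_cols_def)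

lemma col_leading_cols: "j < i \<Longrightarrow> i \<le> dim_col M \<Longrightarrow> col (leading_cols i M) j = col M j"
  by (intro eq_vecI) (auto simp: leading_cols_def)

lemma col_trailing_cols: "j < dim_col M - i \<Longrightarrow> col (trailing_cols i M) j = col M (j + i)"
  by (intro eq_vecI) (auto simp: trailing_cols_def)

lemma sum_split_shift:
  fixes f :: "nat \<Rightarrow> real"
  assumes "k \<le> n"
  shows "(\<Sum>l<n. f l) = (\<Sum>l<k. f l) + (\<Sum>l<n - k. f (l + k))"
proof -
  have "(\<Sum>l<n. f l) = (\<Sum>l<k. f l) + (\<Sum>l=k..<n. f l)"
    using assms by (metis atLeast0LessThan le0 sum.atLeastLessThan_concat)
  also have "(\<Sum>l=k..<n. f l) = (\<Sum>l<n - k. f (l + k))"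
    using sum.shift_bounds_nat_ivl[of f 0 k "n - k"] assms by (simp add: atLeast0LessThan)
  finally show ?thesis .
qed

text \<open>Splits Parseval's identity at index \<open>k\<close>; in angles, \<open>cos\<^sup>2 + sin\<^sup>2 = 1\<close>.\<close>

lemma leading_trailing_energy:
  assumes V: "orthonormal_cols V" "V \<in> carrier_mat n n" and k: "k \<le> n" and x: "x \<in> carrier_vec n"
  shows "(transpose_mat (leading_cols k V) *\<^sub>v x) \<bullet> (transpose_mat (leading_cols k V) *\<^sub>v x)
    + (transpose_mat (trailing_cols k V) *\<^sub>v x) \<bullet> (transpose_mat (trailing_cols k V) *\<^sub>v x) = x \<bullet> x"
proof -
  have d: "dim_col (leading_cols k V) = k" "dim_col (trailing_cols k V) = n - k"
    using V by (simp_all add: leading_cols_def trailing_cols_def)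
  show ?thesis
    using V k parseval[OF V x] sum_split_shift[OF k, of "\<lambda>l. (col V l \<bullet> x)\<^sup>2"]
    by (simp add: transpose_mult_vec_self d col_leading_cols col_trailing_cols)
qed

text \<open>The truncated decomposition is itself the projection of \<open>A\<close> onto an \<open>i\<close>-dimensional space, hence subject to
  the same residual formula as the computed approximation.\<close>

lemma truncated_svd_eq_projection:
  assumes svd: "full_svd A U S V" "A \<in> carrier_mat m n" and i: "i \<le> min m n"
  shows "truncated_svd i U S V = leading_cols i U * transpose_mat (leading_cols i U) * A"
proof -
  note D = full_svdD[OF svd]
  let ?L = "leading_cols i U"
  have L: "?L \<in> carrier_mat m i" "leading_cols i V \<in> carrier_mat n i" "leading_block i S \<in> carrier_mat i i"
    using D(1,3) by (auto simp: leading_cols_def leading_block_def)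
  have "leading_block i S * transpose_mat (leading_cols i V) = transpose_mat ?L * A"
  proof (rule eq_matI)
    show "dim_row (leading_block i S * transpose_mat (leading_cols i V)) = dim_row (transpose_mat ?L * A)"
      "dim_col (leading_block i S * transpose_mat (leading_cols i V)) = dim_col (transpose_mat ?L * A)"
      using L svd(2) by auto
    fix l c assume "l < dim_row (transpose_mat ?L * A)" "c < dim_col (transpose_mat ?L * A)"
    then have lc: "l < i" "c < n" using L svd(2) by auto
    have "(leading_block i S * transpose_mat (leading_cols i V)) $$ (l,c)
      = (\<Sum>j<i. S $$ (l,j) * V $$ (c,j))"
      using L lc D by (simp add: scalar_prod_def atLeast0LessThan) (simp add: leading_block_def leading_cols_def)
    also have "\<dots> = (\<Sum>j<i. if j = l then S $$ (l,l) * V $$ (c,l) else 0)"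
      using D(5,6) lc i by (intro sum.cong refl) (auto simp: diagonal_mat_def)
    also have "\<dots> = S $$ (l,l) * V $$ (c,l)" using lc by (simp add: sum.delta)
    also have "\<dots> = col U l \<bullet> (A *\<^sub>v unit_vec n c)"
      using lc i D(3) by (simp add: full_svd_coord[OF svd])
    also have "A *\<^sub>v unit_vec n c = col A c" using svd(2) lc by (intro eq_vecI) auto
    also have "col U l \<bullet> col A c = (transpose_mat ?L * A) $$ (l,c)"
      using L svd(2) lc i D(1) by (simp add: col_leading_cols)
    finally show "(leading_block i S * transpose_mat (leading_cols i V)) $$ (l,c) = (transpose_mat ?L * A) $$ (l,c)" .
  qed
  moreover have "truncated_svd i U S V = ?L * (leading_block i S * transpose_mat (leading_cols i V))"
    unfolding truncated_svd_def using L by (intro assoc_mult_mat) auto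
  moreover have "?L * transpose_mat ?L * A = ?L * (transpose_mat ?L * A)"
    using L svd(2) by (intro assoc_mult_mat) auto
  ultimately show ?thesis by (simp del: assoc_mult_mat)
qed

section \<open>Error bounds from captured energy\<close>

lemma residual_mult_vec:
  fixes A :: "real mat"
  assumes A: "A \<in> carrier_mat m n" and Q: "Q \<in> carrier_mat m r" and x: "x \<in> carrier_vec n"
  shows "(A - Q * transpose_mat Q * A) *\<^sub>v x = A *\<^sub>v x - Q *\<^sub>v (transpose_mat Q *\<^sub>v (A *\<^sub>v x))"
proof -
  have Ax: "A *\<^sub>v x \<in> carrier_vec m" using A x by simp
  have QQ: "Q * transpose_mat Q \<in> carrier_mat m m" using Q by simp
  have "(A - Q * transpose_mat Q * A) *\<^sub>v x = A *\<^sub>v x - (Q * transpose_mat Q * A) *\<^sub>v x"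
    using A QQ x by (intro minus_mult_distrib_mat_vec[of _ m n]) auto
  also have "(Q * transpose_mat Q * A) *\<^sub>v x = Q * transpose_mat Q *\<^sub>v (A *\<^sub>v x)"
    using assoc_mult_mat_vec[OF QQ A x] .
  also have "\<dots> = Q *\<^sub>v (transpose_mat Q *\<^sub>v (A *\<^sub>v x))"
    using assoc_mult_mat_vec[OF Q _ Ax, of "transpose_mat Q"] Q by simp
  finally show ?thesis .
qed

lemma sqrt_sum_squares_le_add:
  fixes a b c :: real
  assumes "c\<^sup>2 \<le> a\<^sup>2 + b\<^sup>2" "0 \<le> a" "0 \<le> b"
  shows "c \<le> a + b"
proof (rule power2_le_imp_le)
  show "c\<^sup>2 \<le> (a + b)\<^sup>2" using assms mult_nonneg_nonneg[of a b] unfolding power2_sum by linarith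
qed (use assms in simp)

lemma ky_fan_left:
  assumes svd: "full_svd A U S V" "A \<in> carrier_mat m n"
    and Y: "orthonormal_cols Y" "Y \<in> carrier_mat m r" and r: "r \<le> min m n"
  shows "(\<Sum>j<r. (transpose_mat A *\<^sub>v col Y j) \<bullet> (transpose_mat A *\<^sub>v col Y j)) \<le> (\<Sum>l<r. (S $$ (l,l))\<^sup>2)"
proof -
  have "(\<Sum>j<r. (transpose_mat A *\<^sub>v col Y j) \<bullet> (transpose_mat A *\<^sub>v col Y j))
    \<le> (\<Sum>l<r. (transpose_mat S $$ (l,l))\<^sup>2)"
    using ky_fan[OF full_svd_transpose[OF svd] _ Y, of n] svd(2) r by simp
  also have "\<dots> = (\<Sum>l<r. (S $$ (l,l))\<^sup>2)"
    using full_svdD(5)[OF svd] r by (intro sum.cong refl) simp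
  finally show ?thesis .
qed

lemma full_svd_left_vector_norm:
  assumes svd: "full_svd A U S V" "A \<in> carrier_mat m n" and j: "j < min m n"
  shows "(transpose_mat A *\<^sub>v col U j) \<bullet> (transpose_mat A *\<^sub>v col U j) = (S $$ (j,j))\<^sup>2"
  using full_svd_right_vector_norm[OF full_svd_transpose[OF svd], of n m j] svd(2) j full_svdD(5)[OF svd]
  by simp

text \<open>Both squared errors are \<open>\<parallel>A\<parallel>\<^sub>F\<^sup>2\<close> minus a captured energy, and the energies differ by at most \<open>d\<^sup>2\<close>.\<close>

lemma frob_norm_residual_le:
  assumes svd: "full_svd A U S V" "A \<in> carrier_mat m n"
    and Q: "orthonormal_cols Q" "Q \<in> carrier_mat m i" and i: "i \<le> min m n" and d: "0 \<le> d"
    and energy: "(\<Sum>j<i. (S $$ (j,j))\<^sup>2) - d\<^sup>2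
      \<le> (\<Sum>j<i. (transpose_mat A *\<^sub>v col Q j) \<bullet> (transpose_mat A *\<^sub>v col Q j))"
  shows "frob_norm (A - Q * transpose_mat Q * A) \<le> frob_norm (A - truncated_svd i U S V) + d"
proof (rule sqrt_sum_squares_le_add)
  note D = full_svdD[OF svd]
  let ?L = "leading_cols i U"
  have L: "orthonormal_cols ?L" "?L \<in> carrier_mat m i"
    using D(1,2) i by (auto intro!: orthonormal_cols_leading_cols leading_cols_carrier)
  have "(\<Sum>j<i. (transpose_mat A *\<^sub>v col ?L j) \<bullet> (transpose_mat A *\<^sub>v col ?L j)) = (\<Sum>j<i. (S $$ (j,j))\<^sup>2)"
    using D(1) i by (intro sum.cong refl) (simp add: col_leading_cols full_svd_left_vector_norm[OF svd])
  then have "(frob_norm (A - truncated_svd i U S V))\<^sup>2 = (frob_norm A)\<^sup>2 - (\<Sum>j<i. (S $$ (j,j))\<^sup>2)"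
    unfolding truncated_svd_eq_projection[OF svd i] frob_norm_square_residual[OF L svd(2)] by simp
  then show "(frob_norm (A - Q * transpose_mat Q * A))\<^sup>2 \<le> (frob_norm (A - truncated_svd i U S V))\<^sup>2 + d\<^sup>2"
    unfolding frob_norm_square_residual[OF Q svd(2)] using energy by simp
qed (use d in auto)

lemma singular_value_le_spectral_norm_truncation:
  assumes svd: "full_svd A U S V" "A \<in> carrier_mat m n" and i: "i < min m n"
  shows "S $$ (i,i) \<le> spectral_norm (A - truncated_svd i U S V)"
proof -
  note D = full_svdD[OF svd]
  let ?L = "leading_cols i U"
  have L: "?L \<in> carrier_mat m i" using D(1) by (rule leading_cols_carrier)
  have v: "col V i \<in> carrier_vec n" and u: "col U i \<in> carrier_vec m" using D(1,3) by (auto intro!: carrier_vecI)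
  have vv: "col V i \<bullet> col V i = 1" "col U i \<bullet> col U i = 1" using D i by (auto simp: orthonormal_cols_iff)
  have "transpose_mat ?L *\<^sub>v col U i = 0\<^sub>v i"
    using D(1,2) L i by (intro eq_vecI) (auto simp: col_leading_cols orthonormal_cols_iff)
  moreover have "S $$ (i,i) \<cdot>\<^sub>v 0\<^sub>v i = (0\<^sub>v i :: real vec)" by (intro eq_vecI) auto
  ultimately have z: "transpose_mat ?L *\<^sub>v (S $$ (i,i) \<cdot>\<^sub>v col U i) = 0\<^sub>v i"
    using mult_mat_vec[of "transpose_mat ?L" i m "col U i"] L u by simp
  have z': "?L *\<^sub>v 0\<^sub>v i = 0\<^sub>v m" using L by (intro eq_vecI) auto
  have "S $$ (i,i) \<cdot>\<^sub>v col U i - 0\<^sub>v m = S $$ (i,i) \<cdot>\<^sub>v col U i" using u by (intro eq_vecI) auto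
  then have "(A - truncated_svd i U S V) *\<^sub>v col V i = S $$ (i,i) \<cdot>\<^sub>v col U i"
    unfolding truncated_svd_eq_projection[OF svd less_imp_le[OF i]] residual_mult_vec[OF svd(2) L v]
      full_svd_right_vector[OF svd i] z z' .
  then have "vec_norm2 ((A - truncated_svd i U S V) *\<^sub>v col V i) = S $$ (i,i)"
    using vv D(8)[OF i] by (simp only: vec_norm2_smult) (simp add: vec_norm2_def)
  moreover have "dim_col (A - truncated_svd i U S V) = n"
    using i svd(2) L by (simp add: truncated_svd_eq_projection[OF svd])
  ultimately show ?thesis
    using spectral_norm_bound[of "col V i" "A - truncated_svd i U S V"] v vv by (simp add: vec_norm2_def)
qed

text \<open>A direction \<open>y\<close> orthogonal to the columns of \<open>Q\<close> extends \<open>Q\<close> to an orthonormal system of \<open>i + 1\<close> vectors. By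
  Ky Fan the whole system captures at most \<open>\<sigma>\<^sub>0\<^sup>2 + \<dots> + \<sigma>\<^sub>i\<^sup>2\<close>, of which \<open>Q\<close> alone already takes all but
  \<open>\<sigma>\<^sub>i\<^sup>2 + d\<^sup>2\<close>. So \<open>\<parallel>A\<^sup>T y\<parallel> \<le> \<sigma>\<^sub>i + d\<close>, and \<open>\<sigma>\<^sub>i\<close> is at most the spectral error of the truncation.\<close>

lemma spectral_norm_residual_le:
  assumes svd: "full_svd A U S V" "A \<in> carrier_mat m n"
    and Q: "orthonormal_cols Q" "Q \<in> carrier_mat m i" and i: "i < min m n" and d: "0 \<le> d"
    and energy: "(\<Sum>j<i. (S $$ (j,j))\<^sup>2) - d\<^sup>2
      \<le> (\<Sum>j<i. (transpose_mat A *\<^sub>v col Q j) \<bullet> (transpose_mat A *\<^sub>v col Q j))"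
  shows "spectral_norm (A - Q * transpose_mat Q * A) \<le> spectral_norm (A - truncated_svd i U S V) + d"
proof -
  note D = full_svdD[OF svd]
  have "spectral_norm (A - Q * transpose_mat Q * A) \<le> S $$ (i,i) + d"
  proof (rule spectral_norm_leI)
    show "0 \<le> S $$ (i,i) + d" using D(8)[OF i] d by simp
    fix x :: "real vec" assume "x \<in> carrier_vec (dim_col (A - Q * transpose_mat Q * A))"
    then have x: "x \<in> carrier_vec n" using svd(2) by simp
    define r where "r = (A - Q * transpose_mat Q * A) *\<^sub>v x"
    have Ax: "A *\<^sub>v x \<in> carrier_vec m" using svd(2) x by simp
    have QtAx: "transpose_mat Q *\<^sub>v (A *\<^sub>v x) \<in> carrier_vec i" using Q Ax by simp
    have r_eq: "r = A *\<^sub>v x - Q *\<^sub>v (transpose_mat Q *\<^sub>v (A *\<^sub>v x))"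
      unfolding r_def by (rule residual_mult_vec[OF svd(2) Q(2) x])
    have r: "r \<in> carrier_vec m" using Ax Q by (simp add: r_eq)
    have Qr: "transpose_mat Q *\<^sub>v r = 0\<^sub>v i"
    proof -
      have "transpose_mat Q *\<^sub>v (Q *\<^sub>v (transpose_mat Q *\<^sub>v (A *\<^sub>v x))) = transpose_mat Q *\<^sub>v (A *\<^sub>v x)"
        by (rule orthonormal_cols_left_inverse[OF Q QtAx])
      moreover have "transpose_mat Q *\<^sub>v r = transpose_mat Q *\<^sub>v (A *\<^sub>v x)
          - transpose_mat Q *\<^sub>v (Q *\<^sub>v (transpose_mat Q *\<^sub>v (A *\<^sub>v x)))"
        unfolding r_eq using Q Ax by (intro mult_minus_distrib_mat_vec[of _ i m]) auto
      ultimately show ?thesis using QtAx by simp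
    qed
    have rr: "r \<bullet> r = (transpose_mat A *\<^sub>v r) \<bullet> x"
    proof -
      have "r \<bullet> r = r \<bullet> (A *\<^sub>v x) - r \<bullet> (Q *\<^sub>v (transpose_mat Q *\<^sub>v (A *\<^sub>v x)))"
        using r Ax Q by (subst (2) r_eq) (rule scalar_prod_minus_distrib[of _ m], auto)
      also have "r \<bullet> (Q *\<^sub>v (transpose_mat Q *\<^sub>v (A *\<^sub>v x))) = 0"
        using transpose_vec_mult_scalar[OF Q(2) QtAx r] Qr QtAx by simp
      finally show ?thesis using transpose_vec_mult_scalar[OF svd(2) x r] by simp
    qed
    show "vec_norm2 ((A - Q * transpose_mat Q * A) *\<^sub>v x) \<le> (S $$ (i,i) + d) * vec_norm2 x"
      unfolding r_def[symmetric]
    proof (cases "vec_norm2 r = 0")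
      case False
      define c where "c = vec_norm2 r"
      have c: "0 < c" using False by (simp add: c_def less_le)
      define y where "y = (1/c) \<cdot>\<^sub>v r"
      have y: "y \<in> carrier_vec m" using r by (simp add: y_def)
      have yy: "y \<bullet> y = 1"
        unfolding y_def scalar_prod_smult_self using c vec_norm2_square[of r]
        by (simp add: c_def[symmetric] power_divide flip: vec_norm2_square)
      have qy: "col Q j \<bullet> y = 0" if "j < i" for j
        using arg_cong[OF Qr, of "\<lambda>v. v $ j"] that Q(2) r by (simp add: y_def)
      define Y where "Y = mat m (Suc i) (\<lambda>(a,j). if j < i then Q $$ (a,j) else y $ a)"
      have Y: "Y \<in> carrier_mat m (Suc i)" by (simp add: Y_def)
      have colY: "col Y j = (if j < i then col Q j else y)" if "j < Suc i" for j
        using that Q(2) y by (intro eq_vecI) (auto simp: Y_def)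
      have "orthonormal_cols Y"
        unfolding orthonormal_cols_iff
      proof (intro allI impI)
        fix a b assume "a < dim_col Y" "b < dim_col Y"
        then have ab: "a < Suc i" "b < Suc i" using Y by auto
        have "y \<bullet> col Q j = 0" if "j < i" for j
          using qy[OF that] scalar_prod_comm_dim[of y "col Q j"] y Q(2) by simp
        then show "col Y a \<bullet> col Y b = (if a = b then 1 else 0)"
          using ab Q qy yy by (auto simp: colY orthonormal_cols_iff)
      qed
      from ky_fan_left[OF svd this Y] i
      have "(\<Sum>j<Suc i. (transpose_mat A *\<^sub>v col Y j) \<bullet> (transpose_mat A *\<^sub>v col Y j))
        \<le> (\<Sum>j<Suc i. (S $$ (j,j))\<^sup>2)" by simp
      then have "(transpose_mat A *\<^sub>v y) \<bullet> (transpose_mat A *\<^sub>v y) \<le> (S $$ (i,i))\<^sup>2 + d\<^sup>2"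
        using energy by (simp add: colY)
      then have "vec_norm2 (transpose_mat A *\<^sub>v y) \<le> S $$ (i,i) + d"
        using D(8)[OF i] d by - (rule sqrt_sum_squares_le_add, auto)
      moreover have "transpose_mat A *\<^sub>v y = (1/c) \<cdot>\<^sub>v (transpose_mat A *\<^sub>v r)"
        unfolding y_def using svd(2) r by (intro mult_mat_vec[of _ n m]) auto
      ultimately have Ar: "vec_norm2 (transpose_mat A *\<^sub>v r) \<le> (S $$ (i,i) + d) * c"
        using c by (simp add: vec_norm2_smult field_simps)
      have cc: "c * c = r \<bullet> r" using vec_norm2_square[of r] by (simp add: c_def power2_eq_square)
      have "(c * c)\<^sup>2 \<le> (vec_norm2 (transpose_mat A *\<^sub>v r) * vec_norm2 x)\<^sup>2"
        unfolding cc rr power_mult_distrib vec_norm2_square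
        using svd(2) r x by (intro vec_Cauchy_Schwarz[of _ n]) auto
      then have "c * c \<le> vec_norm2 (transpose_mat A *\<^sub>v r) * vec_norm2 x"
        by (rule power2_le_imp_le) simp
      also have "\<dots> \<le> (S $$ (i,i) + d) * c * vec_norm2 x"
        by (intro mult_right_mono Ar) simp
      finally have "c * c \<le> c * ((S $$ (i,i) + d) * vec_norm2 x)" by (simp add: mult_ac)
      then show "vec_norm2 r \<le> (S $$ (i,i) + d) * vec_norm2 x" using c by (simp add: c_def)
    qed (use D(8)[OF i] d in simp)
  qed
  also have "\<dots> \<le> spectral_norm (A - truncated_svd i U S V) + d"
    using singular_value_le_spectral_norm_truncation[OF svd i] by simp
  finally show ?thesis .
qed

text \<open>The first \<open>i\<close> columns capture at most \<open>\<sigma>\<^sub>0\<^sup>2 + \<dots> + \<sigma>\<^bsub>i-1\<^esub>\<^sup>2\<close>; what is missing up to the energy of all \<open>i + 1\<close>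
  columns must come from the last one.\<close>

lemma singular_value_minus_le_norm:
  assumes svd: "full_svd A U S V" "A \<in> carrier_mat m n"
    and Q: "orthonormal_cols Q" "Q \<in> carrier_mat m (Suc i)" and i: "i < min m n" and d: "0 \<le> d"
    and energy: "(\<Sum>j<Suc i. (S $$ (j,j))\<^sup>2) - d\<^sup>2
      \<le> (\<Sum>j<Suc i. (transpose_mat A *\<^sub>v col Q j) \<bullet> (transpose_mat A *\<^sub>v col Q j))"
  shows "S $$ (i,i) - d \<le> vec_norm2 (transpose_mat A *\<^sub>v col Q i)"
proof -
  have L: "orthonormal_cols (leading_cols i Q)" "leading_cols i Q \<in> carrier_mat m i"
    using Q by (auto intro!: orthonormal_cols_leading_cols leading_cols_carrier)
  have "(\<Sum>j<i. (transpose_mat A *\<^sub>v col Q j) \<bullet> (transpose_mat A *\<^sub>v col Q j)) \<le> (\<Sum>j<i. (S $$ (j,j))\<^sup>2)"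
    using ky_fan_left[OF svd L] i Q by (simp add: col_leading_cols)
  then have "(S $$ (i,i))\<^sup>2 \<le> (vec_norm2 (transpose_mat A *\<^sub>v col Q i))\<^sup>2 + d\<^sup>2" using energy by simp
  then have "S $$ (i,i) \<le> vec_norm2 (transpose_mat A *\<^sub>v col Q i) + d"
    using d by - (rule sqrt_sum_squares_le_add, auto)
  then show ?thesis by simp
qed

section \<open>Odd polynomials in the block Krylov space\<close>

lemma poly_odd_eq_sum:
  fixes p :: "real poly"
  assumes "degree p = 2 * q + 1" "\<And>j. even j \<Longrightarrow> coeff p j = 0"
  shows "poly p x = (\<Sum>j\<le>q. coeff p (2 * j + 1) * x ^ (2 * j + 1))"
proof -
  have "(\<Sum>i\<le>2 * q + 1. coeff p i * x ^ i) = (\<Sum>j\<le>q. coeff p (2 * j + 1) * x ^ (2 * j + 1))" for q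
    by (induction q) (use assms(2) in simp_all)
  then show ?thesis using assms(1) by (simp add: poly_altdef)
qed

lemma gram_power_carrier:
  assumes A: "A \<in> carrier_mat m n" and X: "X \<in> carrier_mat n s"
  shows "((A * transpose_mat A) ^\<^sub>m j) * A * X \<in> carrier_mat m s"
proof -
  have "A * transpose_mat A \<in> carrier_mat m m" using A by simp
  then have "((A * transpose_mat A) ^\<^sub>m j) * A \<in> carrier_mat m n"
    using A by (intro mult_carrier_mat[OF pow_carrier_mat])
  then show ?thesis using X by (rule mult_carrier_mat)
qed

lemma krylov_block_in_range:
  fixes A X :: "real mat"
  assumes A: "A \<in> carrier_mat m n" and X: "X \<in> carrier_mat n s" and w: "w \<in> carrier_vec s" and j: "j \<le> q"
  shows "(((A * transpose_mat A) ^\<^sub>m j) * A * X) *\<^sub>v w \<in> mat_range (krylov_mat A X q)"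
proof -
  interpret vec_space "TYPE(real)" m .
  let ?B = "\<lambda>j. ((A * transpose_mat A) ^\<^sub>m j) * A * X"
  have B: "?B j \<in> carrier_mat m s" for j using gram_power_carrier[OF A X] .
  have "set (cols (?B j)) \<subseteq> carrier_vec m" for j
    using cols_dim[of "?B j"] unfolding carrier_matD(1)[OF B] .
  then have "cols (krylov_mat A X q) = concat (map (\<lambda>j. cols (?B j)) [0..<q + 1])"
    unfolding krylov_mat_def using A by (intro cols_mat_of_cols) auto
  moreover have "j \<in> set [0..<q + 1]" using j by (simp only: set_upt atLeastLessThan_iff) simp
  ultimately have sub: "set (cols (?B j)) \<subseteq> set (cols (krylov_mat A X q))"
    by (simp only: set_concat set_map) blast
  have "?B j *\<^sub>v w \<in> col_space (?B j)" 
    using mult_mat_vec_carrier[OF B w] w unfolding col_space_eq[OF B] carrier_matD[OF B] by blast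
  also have "\<dots> \<subseteq> col_space (krylov_mat A X q)"
    unfolding col_space_def using span_is_monotone[OF sub] .
  finally show ?thesis using A by (simp add: krylov_mat_def)
qed

text \<open>In the left singular basis, multiplication by \<open>A A\<^sup>T\<close> is multiplication by \<open>\<sigma>\<^sub>l\<^sup>2\<close>. Where the diagonal of the
  rectangular \<open>S\<close> has ended, the coordinate vanishes.\<close>

lemma full_svd_gram_power_coord:
  assumes svd: "full_svd A U S V" "A \<in> carrier_mat m n" and l: "l < m" and x: "x \<in> carrier_vec n"
  shows "col U l \<bullet> (((A * transpose_mat A) ^\<^sub>m j) *\<^sub>v (A *\<^sub>v x))
    = (if l < n then (S $$ (l,l)) ^ (2 * j + 1) * (col V l \<bullet> x) else 0)"
proof -
  note D = full_svdD[OF svd]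
  let ?G = "A * transpose_mat A"
  have At: "transpose_mat A \<in> carrier_mat n m" using svd(2) by simp
  have G: "?G \<in> carrier_mat m m" using svd(2) by simp
  have step: "col U l \<bullet> (?G *\<^sub>v z) = (if l < n then (S $$ (l,l))\<^sup>2 else 0) * (col U l \<bullet> z)"
    if z: "z \<in> carrier_vec m" for z
  proof -
    have "?G *\<^sub>v z = A *\<^sub>v (transpose_mat A *\<^sub>v z)" using assoc_mult_mat_vec[OF svd(2) At z] .
    moreover have "transpose_mat A *\<^sub>v z \<in> carrier_vec n" using At z by simp
    ultimately show ?thesis
      using full_svd_coord[OF svd _ l, of "transpose_mat A *\<^sub>v z"] l D(5)
        full_svd_coord[OF full_svd_transpose[OF svd] At z, of l]
      by (simp add: power2_eq_square)
  qed
  have "col U l \<bullet> ((?G ^\<^sub>m j) *\<^sub>v z) = (if l < n then (S $$ (l,l))\<^sup>2 else 0) ^ j * (col U l \<bullet> z)"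
    if "z \<in> carrier_vec m" for z
    using that
  proof (induction j arbitrary: z)
    case 0
    then show ?case using svd(2) by simp
  next
    case (Suc j)
    have "(?G ^\<^sub>m Suc j) *\<^sub>v z = (?G ^\<^sub>m j) *\<^sub>v (?G *\<^sub>v z)"
      using assoc_mult_mat_vec[OF pow_carrier_mat[OF G] G Suc.prems] by simp
    moreover have "?G *\<^sub>v z \<in> carrier_vec m" using G Suc.prems by (rule mult_mat_vec_carrier)
    ultimately show ?case using Suc.IH[of "?G *\<^sub>v z"] step[OF Suc.prems] by simp
  qed
  from this[of "A *\<^sub>v x"] show ?thesis
    using svd(2) x full_svd_coord[OF svd x l] by (simp add: power_mult)
qed

lemma range_projection:
  assumes Q: "orthonormal_cols Q" "Q \<in> carrier_mat m r" and y: "y \<in> mat_range Q"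
  shows "y \<in> carrier_vec m" "Q *\<^sub>v (transpose_mat Q *\<^sub>v y) = y"
proof -
  obtain a where a: "a \<in> carrier_vec r" "Q *\<^sub>v a = y" "y \<in> carrier_vec m"
    using y Q(2) vec_space.col_space_eq[OF Q(2)] by auto
  show "y \<in> carrier_vec m" by fact
  show "Q *\<^sub>v (transpose_mat Q *\<^sub>v y) = y"
    using orthonormal_cols_left_inverse[OF Q a(1)] a(2) by auto
qed

text \<open>The vector is \<open>h = \<phi>(A) X w\<close>, a linear combination of the vectors \<open>(A A\<^sup>T)\<^sup>j A X w\<close>, which lie in the ranges of
  the blocks of the Krylov matrix. Membership in the range of \<open>Q\<close> is expressed by \<open>Q Q\<^sup>T h = h\<close>, an equation
  that passes to linear combinations entry by entry.\<close>

lemma ex_krylov_polynomial_vec: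
  fixes A X :: "real mat" and p :: "real poly"
  assumes svd: "full_svd A U S V" "A \<in> carrier_mat m n" and X: "X \<in> carrier_mat n s"
    and p: "degree p = 2 * q + 1" "\<And>j. even j \<Longrightarrow> coeff p j = 0"
    and Q: "orthonormal_cols Q" "Q \<in> carrier_mat m r" "mat_range Q = mat_range (krylov_mat A X q)"
    and w: "w \<in> carrier_vec s"
  obtains h where "h \<in> carrier_vec m" "Q *\<^sub>v (transpose_mat Q *\<^sub>v h) = h"
    "\<And>l. l < m \<Longrightarrow> col U l \<bullet> h = (if l < n then poly p (S $$ (l,l)) * (col V l \<bullet> (X *\<^sub>v w)) else 0)"
proof -
  note D = full_svdD[OF svd]
  let ?G = "A * transpose_mat A"
  define g where "g j = (((A * transpose_mat A) ^\<^sub>m j) * A * X) *\<^sub>v w" for j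
  define c where "c j = coeff p (2 * j + 1)" for j
  define h where "h = vec m (\<lambda>a. \<Sum>j\<le>q. c j * g j $ a)"
  have G: "?G ^\<^sub>m j \<in> carrier_mat m m" for j using svd(2) by (intro pow_carrier_mat) auto
  have Xw: "X *\<^sub>v w \<in> carrier_vec n" using X w by simp
  have g_eq: "g j = (?G ^\<^sub>m j) *\<^sub>v (A *\<^sub>v (X *\<^sub>v w))" for j
  proof -
    have GA: "?G ^\<^sub>m j * A \<in> carrier_mat m n" using G svd(2) by (rule mult_carrier_mat)
    show ?thesis unfolding g_def
      using assoc_mult_mat_vec[OF GA X w] assoc_mult_mat_vec[OF G svd(2) Xw] by simp
  qed
  have g: "g j \<in> carrier_vec m" "Q *\<^sub>v (transpose_mat Q *\<^sub>v g j) = g j" if "j \<le> q" for j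
    using range_projection[OF Q(1,2)] krylov_block_in_range[OF svd(2) X w that] Q(3)
    by (simp_all add: g_def)
  have lin: "v \<bullet> h = (\<Sum>j\<le>q. c j * (v \<bullet> g j))" if v: "v \<in> carrier_vec m" for v
  proof -
    have "v \<bullet> h = (\<Sum>a<m. \<Sum>j\<le>q. v $ a * (c j * g j $ a))"
      by (simp add: h_def scalar_prod_def atLeast0LessThan sum_distrib_left)
    also have "\<dots> = (\<Sum>j\<le>q. \<Sum>a<m. v $ a * (c j * g j $ a))" by (rule sum.swap)
    also have "\<dots> = (\<Sum>j\<le>q. c j * (v \<bullet> g j))"
    proof (intro sum.cong refl)
      fix j assume "j \<in> {..q}"
      then have "dim_vec (g j) = m" using g(1)[of j] by auto
      then show "(\<Sum>a<m. v $ a * (c j * g j $ a)) = c j * (v \<bullet> g j)"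
        by (simp add: scalar_prod_def atLeast0LessThan sum_distrib_left mult_ac)
    qed
    finally show ?thesis .
  qed
  have h: "h \<in> carrier_vec m" by (simp add: h_def)
  show thesis
  proof (rule that[OF h])
    let ?P = "Q * transpose_mat Q"
    have P: "?P \<in> carrier_mat m m" using Q(2) by simp
    have Pz: "?P *\<^sub>v z = Q *\<^sub>v (transpose_mat Q *\<^sub>v z)" if "z \<in> carrier_vec m" for z
      using assoc_mult_mat_vec[OF Q(2) _ that, of "transpose_mat Q"] Q(2) by simp
    have "?P *\<^sub>v h = h"
    proof (rule eq_vecI)
      fix a assume "a < dim_vec h"
      then have a: "a < m" using h by auto
      have ra: "row ?P a \<in> carrier_vec m" using Q(2) by (intro carrier_vecI) simp
      have "(?P *\<^sub>v h) $ a = (\<Sum>j\<le>q. c j * (row ?P a \<bullet> g j))" using Q(2) a lin[OF ra] by simp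
      also have "\<dots> = (\<Sum>j\<le>q. c j * g j $ a)"
      proof (intro sum.cong refl)
        fix j assume "j \<in> {..q}"
        then have "?P *\<^sub>v g j = g j" using g[of j] Pz by simp
        moreover have "(?P *\<^sub>v g j) $ a = row ?P a \<bullet> g j" using a P by (intro index_mult_mat_vec) (simp only: carrier_matD)
        ultimately show "c j * (row ?P a \<bullet> g j) = c j * g j $ a" by simp
      qed
      finally show "(?P *\<^sub>v h) $ a = h $ a" using a by (simp add: h_def)
    qed (use Q(2) h in auto)
    then show "Q *\<^sub>v (transpose_mat Q *\<^sub>v h) = h" using Pz[OF h] by simp
    fix l assume l: "l < m"
    have ul: "col U l \<in> carrier_vec m" using D(1) by (intro carrier_vecI) simp
    show "col U l \<bullet> h = (if l < n then poly p (S $$ (l,l)) * (col V l \<bullet> (X *\<^sub>v w)) else 0)"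
      unfolding lin[OF ul] g_eq full_svd_gram_power_coord[OF svd l Xw]
      by (simp add: poly_odd_eq_sum[OF p] c_def sum_distrib_right mult.assoc)
  qed
qed

text \<open>The distance of \<open>c u\<close> from the range of \<open>Q\<close> is at most its distance from the point \<open>h\<close> of that range.\<close>

lemma captured_energy_ge:
  assumes Q: "orthonormal_cols Q" "Q \<in> carrier_mat m r" and u: "u \<in> carrier_vec m"
    and h: "h \<in> carrier_vec m" "Q *\<^sub>v (transpose_mat Q *\<^sub>v h) = h"
  shows "c\<^sup>2 * (u \<bullet> u - (transpose_mat Q *\<^sub>v u) \<bullet> (transpose_mat Q *\<^sub>v u))
    \<le> (c \<cdot>\<^sub>v u - h) \<bullet> (c \<cdot>\<^sub>v u - h)"
proof -
  let ?y = "c \<cdot>\<^sub>v u - h" and ?T = "transpose_mat Q"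
  have T: "?T \<in> carrier_mat r m" using Q by simp
  have y: "?y \<in> carrier_vec m" and cu: "c \<cdot>\<^sub>v u \<in> carrier_vec m" using u h by auto
  have Tc: "?T *\<^sub>v (c \<cdot>\<^sub>v u) \<in> carrier_vec r" "?T *\<^sub>v h \<in> carrier_vec r" using T u h by auto
  have Ty: "?T *\<^sub>v ?y = ?T *\<^sub>v (c \<cdot>\<^sub>v u) - ?T *\<^sub>v h"
    using mult_minus_distrib_mat_vec[OF T cu h(1)] .
  have Th: "(?T *\<^sub>v z) \<bullet> (?T *\<^sub>v h) = z \<bullet> h" if "z \<in> carrier_vec m" for z
    using transpose_vec_mult_scalar[OF Q(2) Tc(2) that] h(2) by simp
  have "0 \<le> (?T *\<^sub>v ?y) \<bullet> (?T *\<^sub>v ?y)" by simp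
  then have "(c \<cdot>\<^sub>v u) \<bullet> (c \<cdot>\<^sub>v u) - (?T *\<^sub>v (c \<cdot>\<^sub>v u)) \<bullet> (?T *\<^sub>v (c \<cdot>\<^sub>v u)) \<le> ?y \<bullet> ?y"
    unfolding Ty scalar_prod_diff_self[OF Tc] scalar_prod_diff_self[OF cu h(1)] Th[OF cu] Th[OF h(1)]
    by simp
  then show ?thesis
    unfolding mult_mat_vec[OF T u] scalar_prod_smult_self by (simp add: right_diff_distrib)
qed

section \<open>Energy captured by the algorithm\<close>

lemma diag_apply_trailing_mult_vec_self:
  assumes S: "S \<in> carrier_mat m n" and t: "t \<in> carrier_vec (n - k)"
  shows "(diag_apply f (trailing_block k S) *\<^sub>v t) \<bullet> (diag_apply f (trailing_block k S) *\<^sub>v t)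
    = (\<Sum>l<m - k. (if l < n - k then f (S $$ (l + k, l + k)) * t $ l else 0)\<^sup>2)"
proof -
  let ?D = "diag_apply f (trailing_block k S)"
  have D: "?D \<in> carrier_mat (m - k) (n - k)" "diagonal_mat ?D"
    using S by (auto simp: diag_apply_def trailing_block_def diagonal_mat_def)
  have "(?D *\<^sub>v t) $ l = (if l < n - k then f (S $$ (l + k, l + k)) * t $ l else 0)" if "l < m - k" for l
    using that S unfolding diagonal_mult_vec_index[OF D t that] by (auto simp: diag_apply_def trailing_block_def)
  then show ?thesis using D(1) by (simp add: scalar_prod_self_sum del: index_mult_mat_vec)
qed

text \<open>The heart of the convergence analysis: the Krylov space almost contains \<open>u\<^sub>j\<close> for \<open>j < k\<close>. A right inverse \<open>N\<close>
  of \<open>V\<^sub>k\<^sup>T X\<close>, such as the pseudoinverse, makes \<open>\<phi>(A) X N e\<^sub>j\<close> equal to \<open>\<phi>(\<sigma>\<^sub>j) u\<^sub>j\<close> up to components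
  along the trailing singular vectors.\<close>

lemma krylov_energy:
  fixes A X :: "real mat" and p :: "real poly"
  assumes svd: "full_svd A U S V" "A \<in> carrier_mat m n" and X: "X \<in> carrier_mat n s"
    and k: "k \<le> min m n"
    and p: "degree p = 2 * q + 1" "\<And>j. even j \<Longrightarrow> coeff p j = 0"
      "\<And>j. j < k \<Longrightarrow> S $$ (j,j) \<le> poly p (S $$ (j,j))"
    and Q: "orthonormal_cols Q" "Q \<in> carrier_mat m r" "mat_range Q = mat_range (krylov_mat A X q)"
    and N: "N \<in> carrier_mat s k" "transpose_mat (leading_cols k V) * X * N = 1\<^sub>m k"
    and i: "i \<le> k"
  shows "(\<Sum>j<i. (S $$ (j,j))\<^sup>2)
      - (spectral_norm (diag_apply (poly p) (trailing_block k S))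
         * frob_norm (transpose_mat (trailing_cols k V) * X * N))\<^sup>2
    \<le> (\<Sum>j<i. (transpose_mat Q * A *\<^sub>v col V j) \<bullet> (transpose_mat Q * A *\<^sub>v col V j))"
proof -
  note D = full_svdD[OF svd]
  let ?D = "diag_apply (poly p) (trailing_block k S)" and ?T = "transpose_mat (trailing_cols k V) * X * N"
  let ?W = "transpose_mat Q * A"
  have VL: "transpose_mat (leading_cols k V) \<in> carrier_mat k n" "transpose_mat (trailing_cols k V) \<in> carrier_mat (n - k) n"
    using leading_cols_carrier[OF D(3)] trailing_cols_carrier[OF D(3)] by simp_all
  have T: "?T \<in> carrier_mat (n - k) k" using VL X N by simp
  have Dc: "dim_col ?D = n - k" using D(5) by (simp add: diag_apply_def trailing_block_def)
  have Qt: "transpose_mat Q \<in> carrier_mat r m" using Q by simp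
  have single: "(S $$ (j,j))\<^sup>2 - (?W *\<^sub>v col V j) \<bullet> (?W *\<^sub>v col V j) \<le> (spectral_norm ?D)\<^sup>2 * (col ?T j \<bullet> col ?T j)"
    if j: "j < k" for j
  proof -
    have jmn: "j < min m n" using j k by simp
    have t: "col ?T j \<in> carrier_vec (n - k)" using T by (intro carrier_vecI) (simp only: dim_col carrier_matD)
    have u: "col U j \<in> carrier_vec m" and v: "col V j \<in> carrier_vec n" using D(1,3) by (auto intro!: carrier_vecI)
    have uu: "col U j \<bullet> col U j = 1" using D(1,2) jmn by (auto simp: orthonormal_cols_iff)
    have w: "col N j \<in> carrier_vec s" using N(1) by (intro carrier_vecI) simp
    have Xw: "X *\<^sub>v col N j \<in> carrier_vec n" using X w by simp
    obtain h where h: "h \<in> carrier_vec m" "Q *\<^sub>v (transpose_mat Q *\<^sub>v h) = h"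
      and coord: "\<And>l. l < m \<Longrightarrow> col U l \<bullet> h
        = (if l < n then poly p (S $$ (l,l)) * (col V l \<bullet> (X *\<^sub>v col N j)) else 0)"
      using ex_krylov_polynomial_vec[OF svd X p(1,2) Q w] by blast
    have lead: "col V l \<bullet> (X *\<^sub>v col N j) = (if l = j then 1 else 0)" if "l < k" for l
    proof -
      have "col V l \<bullet> (X *\<^sub>v col N j) = (transpose_mat (leading_cols k V) *\<^sub>v (X *\<^sub>v col N j)) $ l"
        using that k D(3) VL by (simp add: col_leading_cols)
      also have "transpose_mat (leading_cols k V) *\<^sub>v (X *\<^sub>v col N j) = (transpose_mat (leading_cols k V) * X) *\<^sub>v col N j"
        by (rule assoc_mult_mat_vec[OF VL(1) X w, symmetric])
      also have "\<dots> = col (transpose_mat (leading_cols k V) * X * N) j"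
        using VL(1) X N j by (intro col_mult2[symmetric, of _ k s _ k]) auto
      finally show ?thesis using that j by (simp add: N(2))
    qed
    have trail: "col V (l + k) \<bullet> (X *\<^sub>v col N j) = col ?T j $ l" if "l < n - k" for l
    proof -
      have "col V (l + k) \<bullet> (X *\<^sub>v col N j) = (transpose_mat (trailing_cols k V) *\<^sub>v (X *\<^sub>v col N j)) $ l"
        using that k D(3) VL by (simp add: col_trailing_cols)
      also have "transpose_mat (trailing_cols k V) *\<^sub>v (X *\<^sub>v col N j) = (transpose_mat (trailing_cols k V) * X) *\<^sub>v col N j"
        by (rule assoc_mult_mat_vec[OF VL(2) X w, symmetric])
      also have "\<dots> = col ?T j"
        using VL(2) X N j by (intro col_mult2[symmetric, of _ "n - k" s _ k]) auto
      finally show ?thesis .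
    qed
    let ?c = "poly p (S $$ (j,j))"
    let ?y = "?c \<cdot>\<^sub>v col U j - h"
    have y: "?y \<in> carrier_vec m" using u h by simp
    have ycoord: "col U l \<bullet> ?y = (if l = j then ?c else 0) - col U l \<bullet> h" if "l < m" for l
    proof -
      have ul: "col U l \<in> carrier_vec m" using D(1) by (intro carrier_vecI) simp
      have "col U l \<bullet> ?y = col U l \<bullet> (?c \<cdot>\<^sub>v col U j) - col U l \<bullet> h"
        using ul u h by (intro scalar_prod_minus_distrib[of _ m]) auto
      then show ?thesis using D(1,2) that jmn ul u by (auto simp: orthonormal_cols_iff)
    qed
    have "?y \<bullet> ?y = (\<Sum>l<m. (col U l \<bullet> ?y)\<^sup>2)" by (rule parseval[OF D(2,1) y, symmetric])
    also have "\<dots> = (\<Sum>l<k. (col U l \<bullet> ?y)\<^sup>2) + (\<Sum>l<m - k. (col U (l + k) \<bullet> ?y)\<^sup>2)"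
      using k by (intro sum_split_shift) simp
    also have "(\<Sum>l<k. (col U l \<bullet> ?y)\<^sup>2) = 0"
    proof (rule sum.neutral, rule ballI)
      fix l assume "l \<in> {..<k}"
      then show "(col U l \<bullet> ?y)\<^sup>2 = 0" using k by (simp add: ycoord coord lead)
    qed
    also have "(\<Sum>l<m - k. (col U (l + k) \<bullet> ?y)\<^sup>2)
      = (\<Sum>l<m - k. (if l < n - k then poly p (S $$ (l + k, l + k)) * col ?T j $ l else 0)\<^sup>2)"
    proof (intro sum.cong refl)
      fix l assume "l \<in> {..<m - k}"
      then have l: "l + k < m" by simp
      \<comment> \<open>The target \<open>\<phi>(\<sigma>\<^sub>j) u\<^sub>j\<close> has no component here, as \<open>j < k\<close>; only the error of \<open>h\<close> remains.\<close>
      have "col U (l + k) \<bullet> ?y = - (if l < n - k then poly p (S $$ (l + k, l + k)) * col ?T j $ l else 0)"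
        using trail[of l] j unfolding ycoord[OF l] coord[OF l] by auto
      then show "(col U (l + k) \<bullet> ?y)\<^sup>2 = (if l < n - k then poly p (S $$ (l + k, l + k)) * col ?T j $ l else 0)\<^sup>2"
        by (simp only: power2_minus)
    qed
    also have "\<dots> = (?D *\<^sub>v col ?T j) \<bullet> (?D *\<^sub>v col ?T j)"
      by (rule diag_apply_trailing_mult_vec_self[OF D(5) t, symmetric])
    also have "\<dots> = (vec_norm2 (?D *\<^sub>v col ?T j))\<^sup>2" by simp
    also have "\<dots> \<le> (spectral_norm ?D * vec_norm2 (col ?T j))\<^sup>2"
      using t Dc by (intro power_mono spectral_norm_bound) auto
    also have "\<dots> = (spectral_norm ?D)\<^sup>2 * (col ?T j \<bullet> col ?T j)"
      by (simp only: power_mult_distrib vec_norm2_square)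
    finally have le: "0 + ?y \<bullet> ?y \<le> (spectral_norm ?D)\<^sup>2 * (col ?T j \<bullet> col ?T j)" by simp
    let ?e = "(transpose_mat Q *\<^sub>v col U j) \<bullet> (transpose_mat Q *\<^sub>v col U j)"
    have e: "?e \<le> 1" using bessel[OF Q(1,2) u] transpose_mult_vec_self[of Q "col U j"] Q uu by simp
    have "?W *\<^sub>v col V j = S $$ (j,j) \<cdot>\<^sub>v (transpose_mat Q *\<^sub>v col U j)"
      unfolding assoc_mult_mat_vec[OF Qt svd(2) v] full_svd_right_vector[OF svd jmn] by (rule mult_mat_vec[OF Qt u])
    then have "(S $$ (j,j))\<^sup>2 - (?W *\<^sub>v col V j) \<bullet> (?W *\<^sub>v col V j) = (S $$ (j,j))\<^sup>2 * (1 - ?e)"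
      by (simp only: scalar_prod_smult_self) (simp add: right_diff_distrib)
    \<comment> \<open>The polynomial approximates \<open>\<phi>(\<sigma>\<^sub>j) u\<^sub>j\<close> instead of \<open>\<sigma>\<^sub>j u\<^sub>j\<close>; by \<open>\<sigma>\<^sub>j \<le> \<phi>(\<sigma>\<^sub>j)\<close> this loses nothing.\<close>
    also have "\<dots> \<le> ?c\<^sup>2 * (1 - ?e)"
      using D(8)[OF jmn] p(3)[OF j] e by (intro mult_right_mono power_mono) auto
    also have "\<dots> \<le> ?y \<bullet> ?y"
      using captured_energy_ge[OF Q(1,2) u h, of ?c] uu by simp
    finally show ?thesis using le by simp
  qed
  have "(\<Sum>j<i. (S $$ (j,j))\<^sup>2) - (\<Sum>j<i. (?W *\<^sub>v col V j) \<bullet> (?W *\<^sub>v col V j))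
    \<le> (\<Sum>j<i. (spectral_norm ?D)\<^sup>2 * (col ?T j \<bullet> col ?T j))"
    unfolding sum_subtractf[symmetric] using single i by (intro sum_mono) auto
  also have "\<dots> \<le> (\<Sum>j<k. (spectral_norm ?D)\<^sup>2 * (col ?T j \<bullet> col ?T j))"
    using i by (intro sum_mono2) auto
  also have "\<dots> = (spectral_norm ?D * frob_norm ?T)\<^sup>2"
    unfolding power_mult_distrib frob_norm_square_cols carrier_matD(2)[OF T] by (simp only: sum_distrib_left)
  finally show ?thesis by simp
qed

text \<open>Ky Fan for the right singular side, compared with the left singular vectors, which attain the maximum. It
  replaces the search for a good subspace on the left by evaluation on an explicit system on the right.\<close>

lemma top_left_singular_vectors_energy:
  assumes svd: "full_svd W U S V" "W \<in> carrier_mat r n"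
    and Y: "orthonormal_cols Y" "Y \<in> carrier_mat n i" and i: "i \<le> min r n"
  shows "(\<Sum>j<i. (W *\<^sub>v col Y j) \<bullet> (W *\<^sub>v col Y j))
    \<le> (\<Sum>j<i. (transpose_mat W *\<^sub>v col U j) \<bullet> (transpose_mat W *\<^sub>v col U j))"
  using ky_fan[OF svd Y i] i by (simp add: full_svd_left_vector_norm[OF svd])

text \<open>On the span of the leading left singular vectors of \<open>Q\<^sup>T A\<close>, carried over by the isometry \<open>Q\<close>, the matrix
  \<open>A\<^sup>T\<close> stretches every vector at least by the singular value in question; min-max does the rest.\<close>

lemma compression_singular_value_le:
  assumes svd: "full_svd A U S V" "A \<in> carrier_mat m n"
    and Q: "orthonormal_cols Q" "Q \<in> carrier_mat m r"
    and svdW: "full_svd (transpose_mat Q * A) U' S' V'" and i: "i < min r n" "i < m"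
  shows "S' $$ (i,i) \<le> S $$ (i,i)"
proof -
  let ?W = "transpose_mat Q * A"
  have W: "?W \<in> carrier_mat r n" using Q svd(2) by simp
  note D' = full_svdD[OF svdW W]
  have Wt: "transpose_mat ?W = transpose_mat A * Q" using transpose_mult[of "transpose_mat Q" r m A n] Q svd(2) by simp
  have At: "transpose_mat A \<in> carrier_mat n m" using svd(2) by simp
  let ?L = "leading_cols (Suc i) U'"
  have L: "orthonormal_cols ?L" "?L \<in> carrier_mat r (Suc i)"
    using D'(1) orthonormal_cols_leading_cols[OF D'(2), of "Suc i"] i by (auto intro!: leading_cols_carrier)
  have im: "i < min n m" "i < min n r" using i by auto
  have "S' $$ (i,i) \<le> transpose_mat S $$ (i,i)"
  proof (rule singular_value_ge_of_lower_bound[OF full_svd_transpose[OF svd] At im(1)])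
    show "orthonormal_cols (Q * ?L)" by (rule orthonormal_cols_mult[OF Q L])
    show "Q * ?L \<in> carrier_mat m (Suc i)" using Q(2) L(2) by (rule mult_carrier_mat)
    show "0 \<le> S' $$ (i,i)" using D'(8)[OF i(1)] .
    fix a :: "real vec" assume a: "a \<in> carrier_vec (Suc i)"
    have La: "?L *\<^sub>v a \<in> carrier_vec r" using L a by simp
    have "transpose_mat A *\<^sub>v (Q * ?L *\<^sub>v a) = transpose_mat ?W *\<^sub>v (?L *\<^sub>v a)"
      unfolding assoc_mult_mat_vec[OF Q(2) L(2) a] Wt by (rule assoc_mult_mat_vec[OF At Q(2) La, symmetric])
    moreover have "transpose_mat ?W \<in> carrier_mat n r" using W by simp
    moreover have "transpose_mat S' $$ (i,i) = S' $$ (i,i)" using D'(5) i by simp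
    ultimately show "(S' $$ (i,i))\<^sup>2 * (a \<bullet> a)
      \<le> (transpose_mat A *\<^sub>v (Q * ?L *\<^sub>v a)) \<bullet> (transpose_mat A *\<^sub>v (Q * ?L *\<^sub>v a))"
      using full_svd_leading_right_bound[OF full_svd_transpose[OF svdW W] _ im(2) a] by simp
  qed
  then show ?thesis using full_svdD(5)[OF svd] i by simp
qed

section \<open>Principal angles\<close>

lemma tan_arccos_square:
  assumes "0 < c" "c \<le> 1"
  shows "(tan (arccos c))\<^sup>2 = 1 / c\<^sup>2 - 1"
proof -
  have "c\<^sup>2 \<le> 1" using assms by (simp add: power_le_one)
  then show ?thesis
    using assms by (simp add: tan_def sin_arccos_abs power_divide sin_arccos field_simps)
qed

text \<open>With \<open>V\<^sub>k\<^sup>T X = P C Q\<^sup>T\<close>, the pseudoinverse maps the left singular vector \<open>p\<^sub>j\<close> to \<open>q\<^sub>j / c\<^sub>j\<close>. The vector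
  \<open>X q\<^sub>j / c\<^sub>j\<close> has squared norm \<open>1 / c\<^sub>j\<^sup>2\<close>, of which the leading columns of \<open>V\<close> see \<open>\<parallel>p\<^sub>j\<parallel>\<^sup>2 = 1\<close>; the trailing ones
  see the rest. That this rest is nonnegative also shows that \<open>c\<^sub>j \<le> 1\<close> is a cosine.\<close>

lemma frob_norm_tan_principal_angles:
  assumes V: "orthonormal_cols V" "V \<in> carrier_mat n n" and X: "orthonormal_cols X" "X \<in> carrier_mat n s"
    and k: "k \<le> n" and rank: "mat_rank (transpose_mat (leading_cols k V) * X) = k"
  shows "frob_norm (transpose_mat (trailing_cols k V) * X * pinv (transpose_mat (leading_cols k V) * X))
    = frob_norm (diag_apply tan (principal_angles_mat X (leading_cols k V)))"
proof -
  let ?L = "leading_cols k V" and ?R = "trailing_cols k V"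
  let ?M = "transpose_mat ?L * X"
  have L: "?L \<in> carrier_mat n k" "?R \<in> carrier_mat n (n - k)"
    using leading_cols_carrier[OF V(2)] trailing_cols_carrier[OF V(2)] by auto
  have Lt: "transpose_mat ?L \<in> carrier_mat k n" "transpose_mat ?R \<in> carrier_mat (n - k) n" using L by auto
  have M: "?M \<in> carrier_mat k s" using Lt X by simp
  have Mt: "transpose_mat ?M \<in> carrier_mat s k" using M by simp
  note inj = full_row_rank_transpose_inj[OF M rank]
  obtain P C Q where svd: "full_svd ?M P C Q" and ks: "k \<le> s" and pos: "\<And>i. i < k \<Longrightarrow> 0 < C $$ (i,i)"
    using full_row_rank_svd[OF M inj] by blast
  obtain B where B: "B \<in> carrier_mat k k" "B * (?M * transpose_mat ?M) = 1\<^sub>m k"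
    "?M * transpose_mat ?M * B = 1\<^sub>m k" "pinv ?M = transpose_mat ?M * B"
    using full_row_rank_pinv[OF M inj] by blast
  note D = full_svdD[OF svd M]
  let ?N = "pinv ?M"
  have N: "?N \<in> carrier_mat s k" using B(1,4) Mt by simp
  have T: "transpose_mat ?R * X * ?N \<in> carrier_mat (n - k) k" using Lt X(2) N by simp
  have G: "?M * transpose_mat ?M \<in> carrier_mat k k" using M Mt by (rule mult_carrier_mat)
  have MN: "?M * ?N = 1\<^sub>m k" using assoc_mult_mat[OF M Mt B(1)] B(3,4) by simp
  have energy: "(transpose_mat ?R * X * ?N *\<^sub>v col P j) \<bullet> (transpose_mat ?R * X * ?N *\<^sub>v col P j)
      = 1 / (C $$ (j,j))\<^sup>2 - 1" if j: "j < k" for j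
  proof -
    let ?p = "col P j" and ?q = "col Q j" and ?c = "C $$ (j,j)"
    have c: "?c > 0" using pos[OF j] .
    have p: "?p \<in> carrier_vec k" and q: "?q \<in> carrier_vec s" using D(1,3) by (auto intro!: carrier_vecI)
    have pp: "?p \<bullet> ?p = 1" "?q \<bullet> ?q = 1" using D(1-4) j ks by (auto simp: orthonormal_cols_iff)
    have jk: "j < min s k" "j < min k s" using j ks by auto
    have Mtp: "transpose_mat ?M *\<^sub>v ?p = ?c \<cdot>\<^sub>v ?q"
      using full_svd_right_vector[OF full_svd_transpose[OF svd M] Mt jk(1)] D(5) j ks by simp
    have "?M *\<^sub>v (transpose_mat ?M *\<^sub>v ?p) = ?c \<cdot>\<^sub>v (?c \<cdot>\<^sub>v ?p)"
      unfolding Mtp mult_mat_vec[OF M q] full_svd_right_vector[OF svd M jk(2)] ..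
    then have "?M * transpose_mat ?M *\<^sub>v ?p = ?c\<^sup>2 \<cdot>\<^sub>v ?p"
      unfolding assoc_mult_mat_vec[OF M Mt p] by (simp add: smult_smult_assoc power2_eq_square)
    then have "B *\<^sub>v (?c\<^sup>2 \<cdot>\<^sub>v ?p) = ?p"
      using assoc_mult_mat_vec[OF B(1) G p] B(2) p by simp
    then have "?c\<^sup>2 \<cdot>\<^sub>v (B *\<^sub>v ?p) = ?p" unfolding mult_mat_vec[OF B(1) p] .
    then have "(1/?c\<^sup>2) \<cdot>\<^sub>v (?c\<^sup>2 \<cdot>\<^sub>v (B *\<^sub>v ?p)) = (1/?c\<^sup>2) \<cdot>\<^sub>v ?p" by simp
    then have Bp: "B *\<^sub>v ?p = (1/?c\<^sup>2) \<cdot>\<^sub>v ?p" using c by (simp add: smult_smult_assoc)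
    have "?N *\<^sub>v ?p = (1/?c\<^sup>2) \<cdot>\<^sub>v (?c \<cdot>\<^sub>v ?q)"
      unfolding B(4) assoc_mult_mat_vec[OF Mt B(1) p] Bp mult_mat_vec[OF Mt p] Mtp ..
    then have Np: "?N *\<^sub>v ?p = (1/?c) \<cdot>\<^sub>v ?q"
      using c by (simp add: smult_smult_assoc power2_eq_square)
    let ?z = "X *\<^sub>v (?N *\<^sub>v ?p)"
    have Npc: "?N *\<^sub>v ?p \<in> carrier_vec s" using N p by simp
    have z: "?z \<in> carrier_vec n" using X Npc by simp
    have "?z \<bullet> ?z = 1 / ?c\<^sup>2"
      unfolding orthonormal_cols_isometry[OF X Npc] unfolding Np scalar_prod_smult_self pp
      by (simp add: power_divide)
    moreover have "transpose_mat ?L *\<^sub>v ?z = ?p"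
      using assoc_mult_mat_vec[OF Lt(1) X(2) Npc] assoc_mult_mat_vec[OF M N p] MN p by simp
    moreover have "transpose_mat ?R * X * ?N *\<^sub>v ?p = transpose_mat ?R *\<^sub>v ?z"
    proof -
      have RX: "transpose_mat ?R * X \<in> carrier_mat (n - k) s" using Lt(2) X(2) by (rule mult_carrier_mat)
      show ?thesis
        unfolding assoc_mult_mat_vec[OF RX N p] assoc_mult_mat_vec[OF Lt(2) X(2) Npc] ..
    qed
    ultimately show ?thesis using leading_trailing_energy[OF V k z] pp by simp
  qed
  have "(frob_norm (transpose_mat ?R * X * ?N))\<^sup>2 = (\<Sum>j<k. 1 / (C $$ (j,j))\<^sup>2 - 1)"
    unfolding frob_norm_square_basis[OF D(2,1) T] using energy by simp
  also have "\<dots> = (\<Sum>j<k. (tan (principal_angle X ?L (j + 1)))\<^sup>2)"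
  proof (intro sum.cong refl)
    fix j assume "j \<in> {..<k}"
    then have j: "j < k" by simp
    have c: "C $$ (j,j) > 0" using pos[OF j] .
    have "1 \<le> 1 / (C $$ (j,j))\<^sup>2" using energy[OF j] scalar_prod_self_nonneg by (metis diff_ge_0_iff_ge)
    then have "(C $$ (j,j))\<^sup>2 \<le> 1" using c by (simp add: field_simps)
    then have "C $$ (j,j) \<le> 1" using c by (simp add: abs_square_le_1)
    moreover have "sing_val ?M (j + 1) = C $$ (j,j)" using sing_val_eq[OF svd M, of j] j ks by simp
    ultimately show "1 / (C $$ (j,j))\<^sup>2 - 1 = (tan (principal_angle X ?L (j + 1)))\<^sup>2"
      using tan_arccos_square[OF c] by (simp add: principal_angle_def)
  qed
  also have "\<dots> = (frob_norm (diag_apply tan (principal_angles_mat X ?L)))\<^sup>2"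
  proof -
    have "(frob_norm (diag_apply tan (principal_angles_mat X ?L)))\<^sup>2
      = (\<Sum>i<k. \<Sum>j<k. (if i = j then tan (principal_angle X ?L (i + 1)) else 0)\<^sup>2)"
      using L(1) by (auto simp: frob_norm_def sum_nonneg diag_apply_def principal_angles_mat_def mat_diag_def intro!: sum.cong)
    also have "\<dots> = (\<Sum>i<k. \<Sum>j<k. if i = j then (tan (principal_angle X ?L (i + 1)))\<^sup>2 else 0)"
      by (intro sum.cong refl) simp
    finally show ?thesis by (simp add: sum.delta)
  qed
  finally show ?thesis by (simp add: power2_eq_iff_nonneg)
qed

section \<open>Approximation from a block Krylov space\<close>

theorem theorem2p3:
  fixes A X U S V U\<^sub>K W U\<^sub>W U\<^sub>h :: "real mat"
    and m n s k q :: nat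
    and \<phi> :: "real poly"
    and \<Delta> :: real
    and \<sigma> :: "nat \<Rightarrow> real"
  assumes A: "A \<in> carrier_mat m n"
    and X: "X \<in> carrier_mat n s"
    and svd: "full_svd A U S V"
    and \<sigma>: "\<And>i. \<sigma> i = S $$ (i - 1, i - 1)"
    and k: "1 \<le> k" "k < mat_rank A"
    and gap: "\<sigma> k > \<sigma> (k + 1)" "\<sigma> (k + 1) > 0"
    and q: "1 \<le> q" "k \<le> (q + 1) * s" "(q + 1) * s \<le> m"
    and rank_K: "mat_rank (krylov_mat A X q) = (q + 1) * s"
    and U\<^sub>K: "U\<^sub>K \<in> carrier_mat m ((q + 1) * s)" "orthonormal_cols U\<^sub>K"
      "mat_range U\<^sub>K = mat_range (krylov_mat A X q)"
    and W: "W = transpose_mat U\<^sub>K * A" "mat_rank W \<ge> k"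
    and U\<^sub>W: "top_left_singular_vectors W k U\<^sub>W"
    and U\<^sub>h: "U\<^sub>h = U\<^sub>K * U\<^sub>W"
    and \<phi>: "degree \<phi> = 2 * q + 1" "\<And>j. even j \<Longrightarrow> coeff \<phi> j = 0"
      "invertible_mat (diag_apply (poly \<phi>) (leading_block k S))"
      "\<And>i. 1 \<le> i \<Longrightarrow> i \<le> k \<Longrightarrow> poly \<phi> (\<sigma> i) \<ge> \<sigma> i"
    and \<Delta>: "\<Delta> = spectral_norm (diag_apply (poly \<phi>) (trailing_block k S)) *
      frob_norm (transpose_mat (trailing_cols k V) * X * pinv (transpose_mat (leading_cols k V) * X))"
    and rank_VX: "mat_rank (transpose_mat (leading_cols k V) * X) = k"
  shows "(\<forall>i. 1 \<le> i \<and> i \<le> k \<longrightarrow>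
           frob_norm (A - leading_cols i U\<^sub>h * transpose_mat (leading_cols i U\<^sub>h) * A)
             \<le> frob_norm (A - truncated_svd i U S V) + \<Delta> \<and>
           spectral_norm (A - leading_cols i U\<^sub>h * transpose_mat (leading_cols i U\<^sub>h) * A)
             \<le> spectral_norm (A - truncated_svd i U S V) + \<Delta> \<and>
           \<sigma> i - \<Delta> \<le> vec_norm2 (transpose_mat A *\<^sub>v col U\<^sub>h (i - 1)) \<and>
           vec_norm2 (transpose_mat A *\<^sub>v col U\<^sub>h (i - 1)) \<le> \<sigma> i) \<and>
         (orthonormal_cols X \<longrightarrow>
           \<Delta> = spectral_norm (diag_apply (poly \<phi>) (trailing_block k S)) *
             frob_norm (diag_apply tan (principal_angles_mat X (leading_cols k V))))"
proof -
  define r where "r = (q + 1) * s"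
  let ?M = "transpose_mat (leading_cols k V) * X"
  let ?N = "pinv ?M"
  note D = full_svdD[OF svd A]
  have Q: "orthonormal_cols U\<^sub>K" "U\<^sub>K \<in> carrier_mat m r" using U\<^sub>K by (simp_all add: r_def)
  have Wc: "W \<in> carrier_mat r n" using W(1) Q(2) A by simp
  have kmn: "k < min m n" using mat_rank_le[OF A] k(2) A by simp
  have krn: "k \<le> min r n" using mat_rank_le[OF Wc] W(2) Wc by simp
  have M: "?M \<in> carrier_mat k s" using leading_cols_carrier[OF D(3), of k] X by simp
  have rank: "mat_rank ?M = k" using rank_VX .
  obtain B where B: "B \<in> carrier_mat k k" "?M * transpose_mat ?M * B = 1\<^sub>m k" "?N = transpose_mat ?M * B"
    using full_row_rank_pinv[OF M full_row_rank_transpose_inj[OF M rank]] by blast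
  have Mt: "transpose_mat ?M \<in> carrier_mat s k" using M by simp
  have N: "?N \<in> carrier_mat s k" "?M * ?N = 1\<^sub>m k"
    using B assoc_mult_mat[OF M Mt B(1)] Mt by (simp_all only: mult_carrier_mat)
  obtain U' S' V' where svdW: "full_svd W U' S' V'" and U\<^sub>W_eq: "U\<^sub>W = leading_cols k U'"
    using U\<^sub>W by (auto simp: top_left_singular_vectors_def)
  note D' = full_svdD[OF svdW Wc]
  have U\<^sub>Wc: "U\<^sub>W \<in> carrier_mat r k" "orthonormal_cols U\<^sub>W"
    using D'(1) orthonormal_cols_leading_cols[OF D'(2), of k] krn by (auto simp: U\<^sub>W_eq intro!: leading_cols_carrier)
  have H: "U\<^sub>h \<in> carrier_mat m k" "orthonormal_cols U\<^sub>h"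
    using orthonormal_cols_mult[OF Q U\<^sub>Wc(2,1)] Q(2) U\<^sub>Wc(1) unfolding U\<^sub>h by auto
  have At: "transpose_mat A \<in> carrier_mat n m" using A by simp
  have image: "transpose_mat A *\<^sub>v col U\<^sub>h j = transpose_mat W *\<^sub>v col U' j" if j: "j < k" for j
  proof -
    have u: "col U' j \<in> carrier_vec r" using D'(1) by (intro carrier_vecI) simp
    have "col U\<^sub>W j = col U' j" unfolding U\<^sub>W_eq using j krn D'(1) by (intro col_leading_cols) auto
    moreover have "col U\<^sub>h j = U\<^sub>K *\<^sub>v col U\<^sub>W j" unfolding U\<^sub>h by (rule col_mult2[OF Q(2) U\<^sub>Wc(1) j])
    ultimately have "transpose_mat A *\<^sub>v col U\<^sub>h j = transpose_mat A * U\<^sub>K *\<^sub>v col U' j"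
      using assoc_mult_mat_vec[OF At Q(2) u] by simp
    also have "transpose_mat A * U\<^sub>K = transpose_mat W"
      unfolding W(1) using transpose_mult[of "transpose_mat U\<^sub>K" r m A n] Q(2) A by simp
    finally show ?thesis .
  qed
  have \<Delta>_nonneg: "0 \<le> \<Delta>" unfolding \<Delta> by (intro mult_nonneg_nonneg spectral_norm_nonneg frob_norm_nonneg)
  have \<phi>_ge: "S $$ (j,j) \<le> poly \<phi> (S $$ (j,j))" if "j < k" for j using \<phi>(4)[of "Suc j"] that by (simp add: \<sigma>)
  have energy: "(\<Sum>j<i. (S $$ (j,j))\<^sup>2) - \<Delta>\<^sup>2
      \<le> (\<Sum>j<i. (transpose_mat A *\<^sub>v col (leading_cols i U\<^sub>h) j) \<bullet> (transpose_mat A *\<^sub>v col (leading_cols i U\<^sub>h) j))"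
    if i: "i \<le> k" for i
  proof -
    let ?Y = "leading_cols i V"
    have Y: "orthonormal_cols ?Y" "?Y \<in> carrier_mat n i"
      using orthonormal_cols_leading_cols[OF D(4), of i] leading_cols_carrier[OF D(3)] D(3) i kmn by auto
    have "(\<Sum>j<i. (S $$ (j,j))\<^sup>2) - \<Delta>\<^sup>2 \<le> (\<Sum>j<i. (W *\<^sub>v col V j) \<bullet> (W *\<^sub>v col V j))"
      unfolding \<Delta> W(1) using kmn
      by (intro krylov_energy[OF svd A X _ \<phi>(1,2) \<phi>_ge Q U\<^sub>K(3) N i]) auto
    also have "\<dots> = (\<Sum>j<i. (W *\<^sub>v col ?Y j) \<bullet> (W *\<^sub>v col ?Y j))"
      using D(3) i kmn by (intro sum.cong refl) (simp add: col_leading_cols)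
    also have "\<dots> \<le> (\<Sum>j<i. (transpose_mat W *\<^sub>v col U' j) \<bullet> (transpose_mat W *\<^sub>v col U' j))"
      using i krn by (intro top_left_singular_vectors_energy[OF svdW Wc Y]) auto
    also have "\<dots> = (\<Sum>j<i. (transpose_mat A *\<^sub>v col (leading_cols i U\<^sub>h) j)
        \<bullet> (transpose_mat A *\<^sub>v col (leading_cols i U\<^sub>h) j))"
      using H(1) i by (intro sum.cong refl) (simp add: col_leading_cols image)
    finally show ?thesis .
  qed
  have bounds: "frob_norm (A - leading_cols i U\<^sub>h * transpose_mat (leading_cols i U\<^sub>h) * A)
        \<le> frob_norm (A - truncated_svd i U S V) + \<Delta> \<and>
      spectral_norm (A - leading_cols i U\<^sub>h * transpose_mat (leading_cols i U\<^sub>h) * A)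
        \<le> spectral_norm (A - truncated_svd i U S V) + \<Delta> \<and>
      \<sigma> i - \<Delta> \<le> vec_norm2 (transpose_mat A *\<^sub>v col U\<^sub>h (i - 1)) \<and>
      vec_norm2 (transpose_mat A *\<^sub>v col U\<^sub>h (i - 1)) \<le> \<sigma> i" if i: "1 \<le> i" "i \<le> k" for i
  proof -
    let ?H = "leading_cols i U\<^sub>h"
    obtain j where j: "i = Suc j" "j < k" using i by (cases i) auto
    have Hi: "orthonormal_cols ?H" "?H \<in> carrier_mat m i"
      using orthonormal_cols_leading_cols[OF H(2), of i] leading_cols_carrier[OF H(1)] H(1) i by auto
    have "frob_norm (A - ?H * transpose_mat ?H * A) \<le> frob_norm (A - truncated_svd i U S V) + \<Delta>"
      using i kmn by (intro frob_norm_residual_le[OF svd A Hi _ \<Delta>_nonneg energy]) auto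
    moreover have "spectral_norm (A - ?H * transpose_mat ?H * A) \<le> spectral_norm (A - truncated_svd i U S V) + \<Delta>"
      using i kmn by (intro spectral_norm_residual_le[OF svd A Hi _ \<Delta>_nonneg energy]) auto
    moreover have "S $$ (j,j) - \<Delta> \<le> vec_norm2 (transpose_mat A *\<^sub>v col ?H j)"
      using j kmn Hi energy[OF i(2)] by (intro singular_value_minus_le_norm[OF svd A _ _ _ \<Delta>_nonneg]) auto
    moreover have "col ?H j = col U\<^sub>h j" using H(1) j i by (intro col_leading_cols) auto
    moreover have "vec_norm2 (transpose_mat A *\<^sub>v col U\<^sub>h j) = S' $$ (j,j)"
      unfolding image[OF j(2)] vec_norm2_def
      using full_svd_left_vector_norm[OF svdW Wc, of j] D'(8)[of j] j krn by simp
    moreover have "S' $$ (j,j) \<le> S $$ (j,j)"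
      using j krn kmn by (intro compression_singular_value_le[OF svd A Q svdW[unfolded W(1)]]) auto
    ultimately show ?thesis by (simp add: \<sigma> j(1))
  qed
  have "\<Delta> = spectral_norm (diag_apply (poly \<phi>) (trailing_block k S)) *
      frob_norm (diag_apply tan (principal_angles_mat X (leading_cols k V)))" if "orthonormal_cols X"
    unfolding \<Delta> using frob_norm_tan_principal_angles[OF D(4,3) that X _ rank] kmn by simp
  with bounds show ?thesis by blast
qed

end
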